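(* Consider the first Painlevé equation $dx/dz = 6y^2+z$, $dy/dz = x$, and the coordinates $X_2 = xy^{-3/2}$, $Z_2 = zy^{-2}$, $\varepsilon_2 = y^{-5/2}$, $\hat X_2 = X_2-2$. There is a local analytic transformation $(x,z)\mapsto(\tilde x,\tilde z)$ (with $y$ unchanged), defined near $(\hat X_2, Z_2,\varepsilon_2)=(0,0,0)$, such that the first Painlevé equation $d^2y/dz^2 = 6y^2+z$ is transformed into the integrable equation $d^2y/d\tilde z^2 = 6y^2$.
   Context: The coordinates $(X_2,Z_2,\varepsilon_2)$ are the inhomogeneous coordinates of the weighted projective space $\mathbb{C}P^3(3,2,4,5)$ related to $(x,y,z)$ by $x = X_2\varepsilon_2^{-3/5}$, $y=\varepsilon_2^{-2/5}$, $z = Z_2\varepsilon_2^{-4/5}$; they are taken modulo $(X_2,Z_2,\varepsilon_2)\sim(-X_2,Z_2,-\varepsilon_2)$ (choice of branch of $y^{1/2}$). A "local analytic transformation $(x,z)\mapsto(\tilde x,\tilde z)$ defined near $(\hat X_2,Z_2,\varepsilon_2)=(0,0,0)$" means: a biholomorphic map $(X_2,Z_2,\varepsilon_2)\mapsto(u_2,v_2,\varepsilon_2)$ defined in a neighborhood of $(2,0,0)$, fixing $(2,0,0)$ and leaving $\varepsilon_2$ (hence $y$) unchanged, with $\tilde x = u_2\varepsilon_2^{-3/5}$ and $\tilde z = v_2\varepsilon_2^{-4/5}$. "Is transformed into $d^2y/d\tilde z^2=6y^2$" means that along every solution of the first Painlevé equation, as long as it stays in this neighborhood (with $\varepsilon_2\neq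 0$), $y$ regarded as a function of $\tilde z$ satisfies this equation. *)

theory Defs
  imports "HOL-Analysis.Analysis"
begin

text \<open>Holomorphy in three complex variables (for open sets): complex Frechet differentiability,
  i.e. the total derivative exists and is complex linear.\<close>

type_synonym complex3 = "complex \<times> complex \<times> complex"

definition holo3_on :: "(complex3 \<Rightarrow> complex) \<Rightarrow> complex3 set \<Rightarrow> bool" where
  "holo3_on f S \<longleftrightarrow>
     (\<forall>p\<in>S. \<exists>a b c. (f has_derivative (\<lambda>(h, k, l). a * h + b * k + c * l)) (at p))"

definition holo3_map_on :: "(complex3 \<Rightarrow> complex3) \<Rightarrow> complex3 set \<Rightarrow> bool" where
  "holo3_map_on F S \<longleftrightarrow>
     holo3_on (\<lambda>p. fst (F p)) S \<and>
     holo3_on (\<lambda>p. fst (snd (F p))) S \<and>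
     holo3_on (\<lambda>p. snd (snd (F p))) S"

definition biholo3_on :: "(complex3 \<Rightarrow> complex3) \<Rightarrow> complex3 set \<Rightarrow> bool" where
  "biholo3_on F U \<longleftrightarrow>
     open U \<and> holo3_map_on F U \<and> inj_on F U \<and>
     open (F ` U) \<and> holo3_map_on (inv_into U F) (F ` U)"

definition PI_solution_on :: "(complex \<Rightarrow> complex) \<Rightarrow> (complex \<Rightarrow> complex) \<Rightarrow> complex set \<Rightarrow> bool" where
  "PI_solution_on x y D \<longleftrightarrow>
     (\<forall>z\<in>D. (x has_field_derivative 6 * (y z)\<^sup>2 + z) (at z) \<and>
             (y has_field_derivative x z) (at z))"

text \<open>The coordinates \<open>(X\<^sub>2, Z\<^sub>2, \<epsilon>\<^sub>2) = (x y^(-3/2), z y^(-2), y^(-5/2))\<close>. The argument \<open>s\<close> is the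
  chosen branch of \<open>y^(1/2)\<close>, so \<open>y = s^2\<close>; exchanging \<open>s\<close> for \<open>-s\<close> acts on the
  coordinates by \<open>branch_flip\<close>.\<close>

definition chart2 :: "complex \<Rightarrow> complex \<Rightarrow> complex \<Rightarrow> complex3" where
  "chart2 s x z = (x / s ^ 3, z / s ^ 4, 1 / s ^ 5)"

fun branch_flip :: "complex3 \<Rightarrow> complex3" where
  "branch_flip (X, Z, e) = (- X, Z, - e)"

text \<open>The new variables \<open>u \<epsilon>\<^sub>2^(-3/5)\<close> and \<open>v \<epsilon>\<^sub>2^(-4/5)\<close>, where \<open>(u, v, \<epsilon>\<^sub>2)\<close> is the image
  of the point under \<open>F\<close> and \<open>s = \<epsilon>\<^sub>2^(-1/5)\<close> is the same branch as in \<open>chart2\<close>.\<close>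

definition x_tilde :: "(complex3 \<Rightarrow> complex3) \<Rightarrow> complex \<Rightarrow> complex \<Rightarrow> complex \<Rightarrow> complex" where
  "x_tilde F s x z = fst (F (chart2 s x z)) * s ^ 3"

definition z_tilde :: "(complex3 \<Rightarrow> complex3) \<Rightarrow> complex \<Rightarrow> complex \<Rightarrow> complex \<Rightarrow> complex" where
  "z_tilde F s x z = fst (snd (F (chart2 s x z))) * s ^ 4"

text \<open>Along a curve \<open>z \<mapsto> (xt z, y z, zt z)\<close>, the quantity \<open>y\<close> regarded (locally) as a holomorphic
  function \<open>Y\<close> of \<open>zt\<close> satisfies \<open>Y'' = 6 Y^2\<close>, with \<open>xt\<close> the derivative of \<open>y\<close>
  with respect to \<open>zt\<close> (just as \<open>x = dy/dz\<close> in the first Painleve equation).\<close>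

definition integrable_solution_on ::
  "(complex \<Rightarrow> complex) \<Rightarrow> (complex \<Rightarrow> complex) \<Rightarrow> (complex \<Rightarrow> complex) \<Rightarrow> complex set \<Rightarrow> bool" where
  "integrable_solution_on xt y zt D \<longleftrightarrow>
     (\<forall>z0\<in>D. \<exists>N Y. open N \<and> z0 \<in> N \<and> N \<subseteq> D \<and>
        inj_on zt N \<and> open (zt ` N) \<and> Y holomorphic_on (zt ` N) \<and>
        (\<forall>z\<in>N. y z = Y (zt z) \<and> xt z = deriv Y (zt z)) \<and>
        (\<forall>w\<in>zt ` N. deriv (deriv Y) w = 6 * (Y w)\<^sup>2))"

end

theory Submission
  imports Defs "HOL-Complex_Analysis.Complex_Analysis"
begin

text \<open>Near a pole, \<open>\<zeta> = 0\<close> for \<open>\<zeta> = z\<^sub>0 - z\<close>, the solutions of the first Painleve equation are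
  \<open>y = \<zeta>\<^bsup>-2\<^esup> G(a, b, c)\<close> with \<open>a = z\<^sub>0 \<zeta>\<^sup>4\<close>, \<open>b = \<zeta>\<^sup>5\<close>, \<open>c = h \<zeta>\<^sup>6\<close>, where \<open>z\<^sub>0\<close> and \<open>h\<close> are the two
  free constants and \<open>G\<close> is a convergent power series in three variables. Expressing
  \<open>(X\<^sub>2, Z\<^sub>2, \<epsilon>\<^sub>2)\<close> through \<open>(a, b, c)\<close> gives a local biholomorphism \<open>\<Phi>\<close> with \<open>\<Phi>(0) = (2, 0, 0)\<close>.
  The equation \<open>y'' = 6 y\<^sup>2\<close> has the first integral \<open>x\<^sup>2 - 4 y\<^sup>3\<close>; prescribing for it the value \<open>4 h\<close>, and \<open>z\<^sub>0\<close>
  for the constant of the remaining quadrature, while keeping \<open>y\<close>, gives a second local biholomorphism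
  \<open>\<Theta>\<close> from \<open>(a, b, c)\<close> to \<open>(u, v, \<epsilon>\<^sub>2)\<close>. The transformation is \<open>\<Theta> \<circ> \<Phi>\<^bsup>-1\<^esup>\<close>.\<close>

section \<open>Holomorphic functions of three variables with continuous derivative\<close>

declare split_paired_All [simp del] split_paired_Ex [simp del]

definition cscale :: "complex \<Rightarrow> complex3 \<Rightarrow> complex3" where
  "cscale c v = (c * fst v, c * fst (snd v), c * snd (snd v))"

text \<open>Complex linearity is encoded as real linearity, which \<open>has_derivative\<close>
  supplies, together with homogeneity under \<open>cscale\<close>. Continuity of the derivative for
  each fixed direction is what the inverse function theorem will use; in finite dimension it amounts
  to continuity in operator norm.\<close>

definition C1_holo :: "(complex3 \<Rightarrow> complex) \<Rightarrow> (complex3 \<Rightarrow> complex3 \<Rightarrow> complex) \<Rightarrow> complex3 set \<Rightarrow> bool" where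
  "C1_holo f f' S \<longleftrightarrow>
     (\<forall>q\<in>S. (f has_derivative f' q) (at q) \<and> (\<forall>c v. f' q (cscale c v) = c * f' q v)) \<and>
     (\<forall>v. continuous_on S (\<lambda>q. f' q v))"

lemma C1_holoD:
  assumes "C1_holo f f' S" "q \<in> S"
  shows "(f has_derivative f' q) (at q)" "f' q (cscale c v) = c * f' q v"
  using assms by (auto simp: C1_holo_def)

lemma C1_holo_continuous_derivative: "C1_holo f f' S \<Longrightarrow> continuous_on S (\<lambda>q. f' q v)"
  by (simp add: C1_holo_def)

lemma C1_holo_continuous: "C1_holo f f' S \<Longrightarrow> continuous_on S f"
  by (meson C1_holoD(1) continuous_at_imp_continuous_on has_derivative_continuous)

lemma complex_linear_triple:
  assumes "linear L" "\<And>c v. L (cscale c v) = c * L v"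
  shows "L = (\<lambda>(h, k, l). L (1, 0, 0) * h + L (0, 1, 0) * k + L (0, 0, 1) * l)"
proof
  fix v :: complex3
  obtain h k l where v: "v = (h, k, l)" by (cases v)
  have "v = cscale h (1,0,0) + cscale k (0,1,0) + cscale l (0,0,1)"
    by (simp add: v cscale_def)
  then have "L v = L (cscale h (1,0,0)) + L (cscale k (0,1,0)) + L (cscale l (0,0,1))"
    using linear_add[OF assms(1)] by metis
  then show "L v = (\<lambda>(h, k, l). L (1, 0, 0) * h + L (0, 1, 0) * k + L (0, 0, 1) * l) v"
    by (simp add: v assms(2) mult.commute)
qed

lemma holo3_onI:
  assumes "\<And>p. p \<in> S \<Longrightarrow> \<exists>L. (f has_derivative L) (at p) \<and> (\<forall>c v. L (cscale c v) = c * L v)"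
  shows "holo3_on f S"
  unfolding holo3_on_def
proof
  fix p assume "p \<in> S"
  then obtain L where L: "(f has_derivative L) (at p)" "\<And>c v. L (cscale c v) = c * L v"
    using assms by blast
  show "\<exists>a b c. (f has_derivative (\<lambda>(h, k, l). a * h + b * k + c * l)) (at p)"
    using complex_linear_triple[OF has_derivative_linear[OF L(1)] L(2)] L(1) by metis
qed

lemma C1_holo_const: "C1_holo (\<lambda>_. c) (\<lambda>_ _. 0) S"
  by (auto simp: C1_holo_def)

lemma C1_holo_coords:
  "C1_holo fst (\<lambda>_. fst) S"
  "C1_holo (\<lambda>q. fst (snd q)) (\<lambda>_ v. fst (snd v)) S"
  "C1_holo (\<lambda>q. snd (snd q)) (\<lambda>_ v. snd (snd v)) S"
  by (auto simp: C1_holo_def cscale_def intro!: derivative_eq_intros)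

lemma C1_holo_add:
  assumes "C1_holo f f' S" "C1_holo g g' S"
  shows "C1_holo (\<lambda>q. f q + g q) (\<lambda>q v. f' q v + g' q v) S"
  using assms unfolding C1_holo_def
  by (auto intro!: has_derivative_add continuous_on_add simp: algebra_simps)

lemma C1_holo_diff:
  assumes "C1_holo f f' S" "C1_holo g g' S"
  shows "C1_holo (\<lambda>q. f q - g q) (\<lambda>q v. f' q v - g' q v) S"
  using assms unfolding C1_holo_def
  by (auto intro!: has_derivative_diff continuous_on_diff simp: algebra_simps)

lemma C1_holo_mult:
  assumes "C1_holo f f' S" "C1_holo g g' S"
  shows "C1_holo (\<lambda>q. f q * g q) (\<lambda>q v. f q * g' q v + f' q v * g q) S"
  unfolding C1_holo_def
  by (intro conjI ballI allI has_derivative_mult continuous_on_add continuous_on_mult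
      C1_holoD(1)[OF assms(1)] C1_holoD(1)[OF assms(2)] C1_holo_continuous[OF assms(1)]
      C1_holo_continuous[OF assms(2)] C1_holo_continuous_derivative[OF assms(1)]
      C1_holo_continuous_derivative[OF assms(2)])
    (simp_all add: C1_holoD(2)[OF assms(1)] C1_holoD(2)[OF assms(2)] algebra_simps)

lemma C1_holo_sum:
  assumes "\<And>i. i \<in> I \<Longrightarrow> C1_holo (f i) (f' i) S"
  shows "C1_holo (\<lambda>q. \<Sum>i\<in>I. f i q) (\<lambda>q v. \<Sum>i\<in>I. f' i q v) S"
  using assms unfolding C1_holo_def
  by (auto intro!: has_derivative_sum continuous_on_sum simp: sum_distrib_left)

text \<open>The continuity of \<open>g'\<close> comes from complex analysis: on the open set
  \<open>T\<close> it agrees with \<open>deriv g\<close>, which is again holomorphic.\<close>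

lemma C1_holo_compose:
  assumes f: "C1_holo f f' S" and g: "\<And>w. w \<in> T \<Longrightarrow> (g has_field_derivative g' w) (at w)"
    and T: "f ` S \<subseteq> T" "open T"
  shows "C1_holo (\<lambda>q. g (f q)) (\<lambda>q v. g' (f q) * f' q v) S"
proof -
  have "g holomorphic_on T"
    using g holomorphic_on_open[OF T(2)] by blast
  then have "deriv g holomorphic_on T"
    using T(2) holomorphic_deriv by blast
  then have "continuous_on T (deriv g)"
    by (rule holomorphic_on_imp_continuous_on)
  then have "continuous_on T g'"
    using g by (metis (no_types, lifting) DERIV_imp_deriv continuous_on_cong)
  then have c: "continuous_on S (\<lambda>q. g' (f q))"
    using continuous_on_compose2[OF _ C1_holo_continuous[OF f] T(1)] by blast
  show ?thesis
    unfolding C1_holo_def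
  proof (intro conjI ballI allI)
    fix q assume q: "q \<in> S"
    show "((\<lambda>q. g (f q)) has_derivative (\<lambda>v. g' (f q) * f' q v)) (at q)"
      using has_derivative_compose[OF C1_holoD(1)[OF f q] g[unfolded has_field_derivative_def]] q T(1)
      by blast
    show "g' (f q) * f' q (cscale c v) = c * (g' (f q) * f' q v)" for c v
      by (simp add: C1_holoD(2)[OF f q])
  next
    show "continuous_on S (\<lambda>q. g' (f q) * f' q v)" for v
      by (intro continuous_on_mult c C1_holo_continuous_derivative[OF f])
  qed
qed

lemma C1_holo_divide_power:
  assumes f: "C1_holo f f' S" and g: "C1_holo g g' S" and nz: "\<And>q. q \<in> S \<Longrightarrow> g q \<noteq> 0"
  shows "C1_holo (\<lambda>q. f q / g q ^ n)
           (\<lambda>q v. f' q v / g q ^ n - of_nat n * f q * g' q v / g q ^ Suc n) S"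
proof -
  have "((\<lambda>w. 1 / w ^ n) has_field_derivative - (of_nat n / w ^ Suc n)) (at w)"
    if "w \<in> - {0}" for w :: complex
  proof (cases n)
    case (Suc m)
    then show ?thesis
      using that by (auto intro!: derivative_eq_intros simp: field_simps; cases m; simp)
  qed auto
  then have "C1_holo (\<lambda>q. f q * (1 / g q ^ n))
     (\<lambda>q v. f q * (- (of_nat n / g q ^ Suc n) * g' q v) + f' q v * (1 / g q ^ n)) S"
    by (intro C1_holo_mult[OF f] C1_holo_compose[OF g, where T = "- {0}"]) (use nz in auto)
  then show ?thesis
    by (simp add: divide_inverse mult_ac del: power_Suc)
qed

text \<open>One majorant \<open>M\<close> serves twice: it gives termwise differentiation on the
  convex set, and the Weierstrass test then makes the differentiated series a uniform limit, hence
  continuous in \<open>q\<close>.\<close>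

lemma C1_holo_series:
  assumes S: "convex S" "open S" "S \<noteq> {}" and f: "\<And>n. C1_holo (f n) (f' n) S"
    and M: "summable M"
    and bf: "\<And>n q. q \<in> S \<Longrightarrow> norm (f n q) \<le> M n"
    and bf': "\<And>n q v. q \<in> S \<Longrightarrow> norm (f' n q v) \<le> M n * norm v"
  shows "C1_holo (\<lambda>q. \<Sum>n. f n q) (\<lambda>q v. \<Sum>n. f' n q v) S"
proof -
  define g where "g = (\<lambda>q v. \<Sum>n. f' n q v)"
  have sm: "summable (\<lambda>n. norm (f' n q v))" if "q \<in> S" for q v
    by (rule summable_comparison_test'[OF summable_mult2[OF M, of "norm v"], of 0])
      (simp add: bf'[OF that])
  \<comment> \<open>The remainder is bounded by a constant times \<open>norm v\<close>, uniformly in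
    \<open>q\<close>; this is operator norm convergence, the form termwise differentiation
    requires.\<close>
  have tail: "norm ((\<Sum>i<n. f' i q v) - g q v) \<le> suminf (\<lambda>i. M (i + n)) * norm v"
    if "q \<in> S" for n q v
  proof -
    have s: "summable (\<lambda>i. norm (f' (i + n) q v))"
      by (rule summable_ignore_initial_segment[OF sm[OF that]])
    have "norm ((\<Sum>i<n. f' i q v) - g q v) = norm (\<Sum>i. f' (i + n) q v)"
      using suminf_minus_initial_segment[OF summable_norm_cancel[OF sm[OF that]], where k = n]
      by (simp add: g_def norm_minus_commute)
    also have "\<dots> \<le> (\<Sum>i. norm (f' (i + n) q v))"
      by (rule summable_norm[OF s])
    also have "\<dots> \<le> (\<Sum>i. M (i + n) * norm v)"
      by (intro suminf_le s summable_mult2 summable_ignore_initial_segment M bf'[OF that])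
    also have "\<dots> = suminf (\<lambda>i. M (i + n)) * norm v"
      by (rule suminf_mult2[symmetric]) (intro summable_ignore_initial_segment M)
    finally show ?thesis .
  qed
  have ev: "\<forall>\<^sub>F n in sequentially. \<forall>q\<in>S. \<forall>v. norm ((\<Sum>i<n. f' i q v) - g q v) \<le> e * norm v"
    if e: "e > 0" for e
  proof -
    obtain N where N: "\<And>n. n \<ge> N \<Longrightarrow> norm (\<Sum>i. M (i + n)) < e"
      using suminf_exist_split[OF e M] by blast
    show ?thesis
      unfolding eventually_sequentially
    proof (intro exI[of _ N] allI impI ballI)
      fix n q and v :: complex3 assume "N \<le> n" "q \<in> S"
      then have "suminf (\<lambda>i. M (i + n)) * norm v \<le> e * norm v"
        using N[of n] by (intro mult_right_mono) auto
      then show "norm ((\<Sum>i<n. f' i q v) - g q v) \<le> e * norm v"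
        by (rule order_trans[OF tail[OF \<open>q \<in> S\<close>]])
    qed
  qed
  obtain q0 where q0: "q0 \<in> S" using S(3) by blast
  have "summable (\<lambda>n. f n q0)"
    by (rule summable_comparison_test'[OF M, of 0]) (rule bf[OF q0])
  moreover have "\<And>n q. q \<in> S \<Longrightarrow> (f n has_derivative f' n q) (at q within S)"
    using f by (meson C1_holoD(1) has_derivative_at_withinI)
  ultimately have "\<exists>F. \<forall>q\<in>S. (\<lambda>n. f n q) sums F q \<and> (F has_derivative g q) (at q within S)"
    by (intro has_derivative_series[OF S(1) _ ev q0 summable_sums])
  then obtain F where F: "\<And>q. q \<in> S \<Longrightarrow> (\<lambda>n. f n q) sums F q"
    "\<And>q. q \<in> S \<Longrightarrow> (F has_derivative g q) (at q within S)"
    by blast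
  show ?thesis
    unfolding C1_holo_def g_def[symmetric]
  proof (intro conjI ballI allI)
    fix q assume q: "q \<in> S"
    have "(F has_derivative g q) (at q)"
      using F(2)[OF q] at_within_open[OF q S(2)] by simp
    then show "((\<lambda>q. \<Sum>n. f n q) has_derivative g q) (at q)"
      by (rule has_derivative_transform_within_open[OF _ S(2) q])
        (use F(1) in \<open>auto simp: sums_iff\<close>)
    show "g q (cscale c v) = c * g q v" for c v
      using C1_holoD(2)[OF f q] suminf_mult[OF summable_norm_cancel[OF sm[OF q]]]
      by (simp add: g_def)
  next
    fix v
    have "uniform_limit S (\<lambda>n q. \<Sum>i<n. f' i q v) (\<lambda>q. g q v) sequentially"
      unfolding g_def
      by (rule Weierstrass_m_test[OF bf' summable_mult2[OF M]])
    then show "continuous_on S (\<lambda>q. g q v)"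
      by (rule uniform_limit_theorem[rotated])
        (use f in \<open>auto simp: C1_holo_def intro!: always_eventually continuous_on_sum\<close>)
  qed
qed

section \<open>Local biholomorphic charts and their transition maps\<close>

definition C1_holo_map :: "(complex3 \<Rightarrow> complex3) \<Rightarrow> (complex3 \<Rightarrow> complex3 \<Rightarrow> complex3) \<Rightarrow> complex3 set \<Rightarrow> bool" where
  "C1_holo_map F F' S \<longleftrightarrow>
     C1_holo (\<lambda>q. fst (F q)) (\<lambda>q v. fst (F' q v)) S \<and>
     C1_holo (\<lambda>q. fst (snd (F q))) (\<lambda>q v. fst (snd (F' q v))) S \<and>
     C1_holo (\<lambda>q. snd (snd (F q))) (\<lambda>q v. snd (snd (F' q v))) S"

lemma C1_holo_mapD:
  assumes "C1_holo_map F F' S" "q \<in> S"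
  shows "(F has_derivative F' q) (at q)" "F' q (cscale c v) = cscale c (F' q v)"
proof -
  have "((\<lambda>q. (fst (F q), fst (snd (F q)), snd (snd (F q)))) has_derivative
         (\<lambda>v. (fst (F' q v), fst (snd (F' q v)), snd (snd (F' q v))))) (at q)"
    using assms by (intro has_derivative_Pair) (auto simp: C1_holo_map_def C1_holo_def)
  then show "(F has_derivative F' q) (at q)"
    by simp
  show "F' q (cscale c v) = cscale c (F' q v)"
    using assms by (auto simp: C1_holo_map_def C1_holo_def prod_eq_iff) (auto simp: cscale_def)
qed

lemma C1_holo_map_subset: "C1_holo_map F F' S \<Longrightarrow> T \<subseteq> S \<Longrightarrow> C1_holo_map F F' T"
  unfolding C1_holo_map_def C1_holo_def by (meson continuous_on_subset subsetD)

definition holo_chart ::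
  "(complex3 \<Rightarrow> complex3) \<Rightarrow> (complex3 \<Rightarrow> complex3 \<Rightarrow> complex3) \<Rightarrow> complex3 set \<Rightarrow> complex3 set \<Rightarrow>
   (complex3 \<Rightarrow> complex3) \<Rightarrow> bool" where
  "holo_chart F F' U V \<Psi> \<longleftrightarrow>
     C1_holo_map F F' U \<and> open U \<and> open V \<and> homeomorphism U V F \<Psi> \<and>
     (\<forall>q\<in>U. bij (F' q) \<and> (\<Psi> has_derivative inv (F' q)) (at (F q)))"

text \<open>An explicit left inverse of the derivative at the base point is enough. The derivatives
  are packaged as bounded linear operators, whose continuity in operator norm is checked direction
  by direction.\<close>

lemma holo_chart_inverse_function:
  assumes F: "C1_holo_map F F' S" and S: "open S" "q0 \<in> S"
    and L: "bounded_linear L" "\<And>v. L (F' q0 v) = v"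
  obtains U V \<Psi> where "holo_chart F F' U V \<Psi>" "U \<subseteq> S" "q0 \<in> U"
proof -
  define D where "D = (\<lambda>q. Blinfun (F' q))"
  have D: "blinfun_apply (D q) = F' q" if "q \<in> S" for q
    unfolding D_def using has_derivative_bounded_linear[OF C1_holo_mapD(1)[OF F that]]
    by (rule bounded_linear_Blinfun_apply)
  have cont: "continuous_on S D"
  proof (rule continuous_on_blinfun_componentwise)
    fix i :: complex3
    have "continuous_on S (\<lambda>q. (fst (F' q i), fst (snd (F' q i)), snd (snd (F' q i))))"
      using F by (intro continuous_on_Pair; simp add: C1_holo_map_def C1_holo_def)
    then have "continuous_on S (\<lambda>q. F' q i)"
      by simp
    then show "continuous_on S (\<lambda>q. blinfun_apply (D q) i)"
      using D by (metis (no_types, lifting) continuous_on_cong)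
  qed
  have inv: "Blinfun L o\<^sub>L D q0 = id_blinfun"
    by (rule blinfun_eqI) (simp add: bounded_linear_Blinfun_apply[OF L(1)] D[OF S(2)] L(2))
  have der: "\<And>q. q \<in> S \<Longrightarrow> (F has_derivative blinfun_apply (D q)) (at q)"
    using C1_holo_mapD(1)[OF F] D by simp
  show ?thesis
  proof (rule inverse_function_theorem[OF S(1) der cont S(2) inv])
    fix U V \<Psi> \<Psi>'
    assume *: "open U" "U \<subseteq> S" "q0 \<in> U" "open V" "homeomorphism U V F \<Psi>"
      "\<And>y. y \<in> V \<Longrightarrow> (\<Psi> has_derivative \<Psi>' y) (at y)"
      "\<And>y. y \<in> V \<Longrightarrow> \<Psi>' y = inv (blinfun_apply (D (\<Psi> y)))"
      "\<And>y. y \<in> V \<Longrightarrow> bij (blinfun_apply (D (\<Psi> y)))"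
    have "bij (F' q) \<and> (\<Psi> has_derivative inv (F' q)) (at (F q))" if "q \<in> U" for q
    proof -
      have q: "F q \<in> V" "\<Psi> (F q) = q" "q \<in> S"
        using *(2,5) that by (auto simp: homeomorphism_def)
      show ?thesis
        using *(6)[OF q(1)] *(8)[OF q(1)] unfolding *(7)[OF q(1)] q(2) D[OF q(3)] by blast
    qed
    then have "holo_chart F F' U V \<Psi>"
      unfolding holo_chart_def using * C1_holo_map_subset[OF F *(2)] by blast
    with * show ?thesis using that by blast
  qed
qed

text \<open>Holomorphy of the inverse of a chart is automatic: the inverse of a complex linear
  bijection is complex linear.\<close>

lemma inv_cscale:
  assumes "bij L" "\<And>c v. L (cscale c v) = cscale c (L v)"
  shows "inv L (cscale c v) = cscale c (inv L v)"
proof -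
  have "L (cscale c (inv L v)) = cscale c v"
    using assms by (simp add: bij_is_surj surj_f_inv_f)
  then show ?thesis
    using bij_is_inj[OF assms(1)] inv_f_f by metis
qed

lemma holo_chart_image:
  assumes "holo_chart F F' U V \<Psi>" "open N" "N \<subseteq> U"
  shows "open (F ` N)" "inj_on F N"
proof -
  have h: "homeomorphism U V F \<Psi>" "open V"
    using assms(1) by (auto simp: holo_chart_def)
  then have "F ` N = V \<inter> \<Psi> -` N"
    using assms(3) by (force simp: homeomorphism_def image_iff)
  then show "open (F ` N)"
    using h assms(2) continuous_open_preimage[of V \<Psi> N] by (simp add: homeomorphism_def)
  show "inj_on F N"
    by (rule inj_on_inverseI[of _ \<Psi>]) (use h(1) assms(3) in \<open>auto simp: homeomorphism_def\<close>)
qed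

lemma holo3_map_on_transition:
  assumes F: "holo_chart F F' U V \<Psi>" and G: "C1_holo_map G G' U2" and N: "N \<subseteq> U" "N \<subseteq> U2"
  shows "holo3_map_on (\<lambda>p. G (\<Psi> p)) (F ` N)"
proof -
  have ex: "\<exists>L. ((\<lambda>p. G (\<Psi> p)) has_derivative L) (at p) \<and> (\<forall>c v. L (cscale c v) = cscale c (L v))"
    if "p \<in> F ` N" for p
  proof -
    obtain q where "p = F q" "q \<in> N" using \<open>p \<in> F ` N\<close> by (rule imageE)
    then have q: "p = F q" "q \<in> U" "q \<in> U2" using N by (simp_all only: subsetD)
    have F': "C1_holo_map F F' U" and \<Psi>: "\<Psi> p = q" "bij (F' q)" "(\<Psi> has_derivative inv (F' q)) (at p)"
      using F q by (auto simp: holo_chart_def homeomorphism_def)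
    have "((\<lambda>p. G (\<Psi> p)) has_derivative (\<lambda>v. G' q (inv (F' q) v))) (at p)"
      using has_derivative_compose[OF \<Psi>(3), of G "G' q"] C1_holo_mapD(1)[OF G q(3)] \<Psi>(1) by simp
    moreover have "G' q (inv (F' q) (cscale c v)) = cscale c (G' q (inv (F' q) v))" for c v
      using inv_cscale[OF \<Psi>(2) C1_holo_mapD(2)[OF F' q(2)]] C1_holo_mapD(2)[OF G q(3)] by simp
    ultimately show ?thesis by blast
  qed
  have *: "\<exists>L. ((\<lambda>p. \<pi> (G (\<Psi> p))) has_derivative L) (at p) \<and> (\<forall>c v. L (cscale c v) = c * L v)"
    if "bounded_linear \<pi>" "\<And>c v. \<pi> (cscale c v) = c * \<pi> v" "p \<in> F ` N" for p and \<pi> :: "complex3 \<Rightarrow> complex"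
  proof -
    note \<pi> = that
    obtain L where L: "((\<lambda>p. G (\<Psi> p)) has_derivative L) (at p)" "\<And>c v. L (cscale c v) = cscale c (L v)"
      using ex[OF \<pi>(3)] by blast
    show ?thesis
      using bounded_linear.has_derivative[OF \<pi>(1) L(1)] \<pi>(2) L(2)
      by (intro exI[of _ "\<lambda>v. \<pi> (L v)"]) simp
  qed
  show ?thesis
    unfolding holo3_map_on_def
    using *[OF bounded_linear_fst]
      *[OF bounded_linear_fst_comp[OF bounded_linear_snd]]
      *[OF bounded_linear_snd_comp[OF bounded_linear_snd]]
    by (intro conjI holo3_onI) (simp_all add: cscale_def)
qed

text \<open>The inverse of a transition map is the transition map with the two charts exchanged, so
  holomorphy of both directions is one lemma applied twice.\<close>

lemma biholo3_on_transition:
  assumes F: "holo_chart F F' U V \<Psi>" and G: "holo_chart G G' U2 V2 \<Psi>2"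
    and N: "open N" "N \<subseteq> U" "N \<subseteq> U2"
  shows "biholo3_on (\<lambda>p. G (\<Psi> p)) (F ` N)"
proof -
  have \<Psi>: "\<And>q. q \<in> N \<Longrightarrow> \<Psi> (F q) = q" "\<And>q. q \<in> N \<Longrightarrow> \<Psi>2 (G q) = q"
    using F G N by (auto simp: holo_chart_def homeomorphism_def)
  let ?T = "\<lambda>p. G (\<Psi> p)"
  have im: "?T ` F ` N = G ` N"
    using \<Psi>(1) by (force simp: image_iff)
  have inj: "inj_on ?T (F ` N)"
    by (rule inj_on_inverseI[of _ "\<lambda>p. F (\<Psi>2 p)"]) (use \<Psi> in auto)
  have inv: "inv_into (F ` N) ?T p = F (\<Psi>2 p)" if "p \<in> G ` N" for p
  proof -
    obtain q where q: "p = G q" "q \<in> N" using \<open>p \<in> G ` N\<close> by blast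
    then show ?thesis
      using inv_into_f_f[OF inj, of "F q"] \<Psi> by simp
  qed
  have "C1_holo_map F F' U" "C1_holo_map G G' U2"
    using F G by (auto simp: holo_chart_def)
  then have 1: "holo3_map_on ?T (F ` N)" and 2: "holo3_map_on (\<lambda>p. F (\<Psi>2 p)) (G ` N)"
    using holo3_map_on_transition[OF F _ N(2,3)] holo3_map_on_transition[OF G _ N(3,2)] by auto
  have op: "open (F ` N)" "open (G ` N)"
    using holo_chart_image F G N by blast+
  \<comment> \<open>\<open>inv_into\<close> agrees with the reversed transition map only on the
    image of \<open>N\<close>; openness of that image lets the derivative be transferred.\<close>
  have *: "holo3_on (\<lambda>p. \<pi> (inv_into (F ` N) ?T p)) (G ` N)"
    if "holo3_on (\<lambda>p. \<pi> (F (\<Psi>2 p))) (G ` N)" for \<pi> :: "complex3 \<Rightarrow> complex"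
    unfolding holo3_on_def
  proof
    fix p assume p: "p \<in> G ` N"
    obtain a b c where
      "((\<lambda>p. \<pi> (F (\<Psi>2 p))) has_derivative (\<lambda>(h, k, l). a * h + b * k + c * l)) (at p)"
      using \<open>holo3_on _ _\<close> p unfolding holo3_on_def by blast
    from has_derivative_transform_within_open[OF this op(2) p]
    show "\<exists>a b c. ((\<lambda>p. \<pi> (inv_into (F ` N) ?T p)) has_derivative
        (\<lambda>(h, k, l). a * h + b * k + c * l)) (at p)"
      using inv by metis
  qed
  have "holo3_map_on (inv_into (F ` N) ?T) (G ` N)"
    using 2 unfolding holo3_map_on_def by (intro conjI *) simp_all
  then show ?thesis
    unfolding biholo3_on_def im using 1 op inj by blast
qed

section \<open>The series solution at a pole\<close>

text \<open>With \<open>\<zeta> d/d\<zeta>\<close> acting as the Euler operator, the equation is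
  \<open>(n - 2)(n - 3) p\<^sub>n = 6 \<Sum>p\<^sub>i p\<^bsub>n-i\<^esub> + [n = 4] a - [n = 5] b\<close>, with a resonance at \<open>n = 6\<close> that leaves
  \<open>p\<^sub>6 = c\<close> free. Moving the terms \<open>i = 0, n\<close> to the left produces the factor \<open>(n + 1)(n - 6)\<close>.\<close>

fun pcoeff :: "complex3 \<Rightarrow> nat \<Rightarrow> complex" where
  "pcoeff q n =
    (if n = 0 then 1 else if n < 4 then 0 else if n = 4 then - fst q / 10
     else if n = 5 then fst (snd q) / 6 else if n = 6 then snd (snd q)
     else 6 * (\<Sum>i=4..n-4. pcoeff q i * pcoeff q (n - i)) / (of_nat (n + 1) * of_nat (n - 6)))"

fun dpcoeff :: "complex3 \<Rightarrow> complex3 \<Rightarrow> nat \<Rightarrow> complex" where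
  "dpcoeff q v n =
    (if n < 4 then 0 else if n = 4 then - fst v / 10
     else if n = 5 then fst (snd v) / 6 else if n = 6 then snd (snd v)
     else 6 * (\<Sum>i=4..n-4. pcoeff q i * dpcoeff q v (n - i) + dpcoeff q v i * pcoeff q (n - i))
       / (of_nat (n + 1) * of_nat (n - 6)))"

declare pcoeff.simps [simp del] dpcoeff.simps [simp del]

lemma pcoeff_rec:
  "n \<ge> 7 \<Longrightarrow> pcoeff q n =
     6 * (\<Sum>i=4..n-4. pcoeff q i * pcoeff q (n - i)) / (of_nat (n + 1) * of_nat (n - 6))"
  by (subst pcoeff.simps) simp

lemma dpcoeff_rec:
  "n \<ge> 7 \<Longrightarrow> dpcoeff q v n =
     6 * (\<Sum>i=4..n-4. pcoeff q i * dpcoeff q v (n - i) + dpcoeff q v i * pcoeff q (n - i))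
       / (of_nat (n + 1) * of_nat (n - 6))"
  by (subst dpcoeff.simps) simp

lemma pcoeff_base:
  "pcoeff q 0 = 1" "pcoeff q (Suc 0) = 0" "pcoeff q 2 = 0" "pcoeff q 3 = 0"
  "pcoeff q 4 = - fst q / 10" "pcoeff q 5 = fst (snd q) / 6" "pcoeff q 6 = snd (snd q)"
  by (simp_all add: pcoeff.simps)

lemma pcoeff_small: "0 < n \<Longrightarrow> n < 4 \<Longrightarrow> pcoeff q n = 0"
  by (subst pcoeff.simps) simp

lemma dpcoeff_base:
  "n < 4 \<Longrightarrow> dpcoeff q v n = 0" "dpcoeff q v 4 = - fst v / 10"
  "dpcoeff q v 5 = fst (snd v) / 6" "dpcoeff q v 6 = snd (snd v)"
  by (simp_all add: dpcoeff.simps)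

lemma weight_cases:
  obtains "n < 4" | "n = 4" | "n = 5" | "n = 6" | "n \<ge> (7::nat)"
  by linarith

section \<open>Geometric bounds for the coefficients and their derivatives\<close>

definition polydisc :: "complex3 set" where
  "polydisc = ball 0 (1/64) \<times> ball 0 (1/64) \<times> ball 0 (1/64)"

lemma polydisc: "convex polydisc" "open polydisc" "0 \<in> polydisc"
  by (auto simp: polydisc_def convex_Times open_Times zero_prod_def)

text \<open>For \<open>n \<ge> 7\<close> the convolution has \<open>n - 7\<close> terms of size at
  most \<open>(1/2)^n\<close>, and \<open>6 (n - 7)\<close> is at most
  \<open>(n + 1) (n - 6)\<close>. The radius \<open>1/64 = (1/2)^6\<close> is what the free
  coefficient at \<open>n = 6\<close> demands.\<close>

lemma norm_pcoeff_le:
  assumes q: "q \<in> polydisc"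
  shows "norm (pcoeff q n) \<le> (1/2) ^ n"
proof (induction n rule: less_induct)
  case (less n)
  have small: "norm (fst q) \<le> 1/64" "norm (fst (snd q)) \<le> 1/64" "norm (snd (snd q)) \<le> 1/64"
    using q by (auto simp: polydisc_def)
  show ?case
  proof (cases rule: weight_cases[of n])
    case 1
    then consider "n = 0" | "n = 1" | "n = 2" | "n = 3" by linarith
    then show ?thesis by cases (simp_all add: pcoeff_base)
  next
    case 5
    have "norm (\<Sum>i=4..n-4. pcoeff q i * pcoeff q (n - i)) \<le> (\<Sum>i=4..n-4. (1/2) ^ n)"
    proof (rule sum_norm_le)
      fix i assume i: "i \<in> {4..n-4}"
      then have in': "i \<le> n" by auto
      have "norm (pcoeff q i * pcoeff q (n - i)) \<le> (1/2) ^ i * (1/2) ^ (n - i)"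
        unfolding norm_mult using i 5 by (intro mult_mono less.IH) auto
      also have "\<dots> = (1/2) ^ n"
        using in' by (simp flip: power_add)
      finally show "norm (pcoeff q i * pcoeff q (n - i)) \<le> (1/2) ^ n" .
    qed
    also have "\<dots> = real (n - 7) * (1/2) ^ n"
      using 5 by simp
    finally have "norm (pcoeff q n) \<le> 6 * (real (n - 7) * (1/2) ^ n) / (real (n + 1) * real (n - 6))"
      unfolding pcoeff_rec[OF 5] norm_divide norm_mult norm_of_nat
      by (intro divide_right_mono) auto
    also have "\<dots> = (1/2) ^ n * (6 * real (n - 7) / (real (n + 1) * real (n - 6)))"
      by simp
    also have "6 * real (n - 7) \<le> real (n + 1) * real (n - 6)"
      using 5 by (intro mult_mono) auto
    then have "(1/2) ^ n * (6 * real (n - 7) / (real (n + 1) * real (n - 6))) \<le> (1/2) ^ n * 1"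
      using 5 by (intro mult_left_mono) (simp_all add: divide_le_eq)
    finally show ?thesis by simp
  qed (use small in \<open>auto simp: pcoeff_base norm_divide power_divide\<close>)
qed

text \<open>The same induction; the product rule doubles the number of terms. The factor
  \<open>64\<close> makes room at \<open>n = 6\<close>, where the derivative is the third component
  of \<open>v\<close> itself.\<close>

lemma norm_dpcoeff_le:
  assumes q: "q \<in> polydisc"
  shows "norm (dpcoeff q v n) \<le> 64 * (1/2) ^ n * norm v"
proof (induction n rule: less_induct)
  case (less n)
  have comp: "norm (fst v) \<le> norm v" "norm (fst (snd v)) \<le> norm v" "norm (snd (snd v)) \<le> norm v"
    using norm_fst_le norm_snd_le order_trans by (metis prod.collapse)+
  show ?case
  proof (cases rule: weight_cases[of n])
    case 5
    let ?B = "64 * (1/2) ^ n * norm v"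
    have "norm (\<Sum>i=4..n-4. pcoeff q i * dpcoeff q v (n - i) + dpcoeff q v i * pcoeff q (n - i))
      \<le> (\<Sum>i=4..n-4. 2 * ?B)"
    proof (rule sum_norm_le)
      fix i assume i: "i \<in> {4..n-4}"
      then have in': "i \<le> n" by auto
      have e: "(1/2) ^ i * (1/2) ^ (n - i) = ((1/2) ^ n :: real)"
        using in' by (simp flip: power_add)
      have "norm (pcoeff q i * dpcoeff q v (n - i)) \<le> (1/2) ^ i * (64 * (1/2) ^ (n - i) * norm v)"
        unfolding norm_mult using i 5 by (intro mult_mono less.IH norm_pcoeff_le[OF q]) auto
      moreover have "norm (dpcoeff q v i * pcoeff q (n - i)) \<le> (64 * (1/2) ^ i * norm v) * (1/2) ^ (n - i)"
        unfolding norm_mult using i 5 by (intro mult_mono less.IH norm_pcoeff_le[OF q]) auto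
      moreover have "(1/2) ^ i * (64 * (1/2) ^ (n - i) * norm v) = ?B"
        "(64 * (1/2) ^ i * norm v) * (1/2) ^ (n - i) = ?B"
        by (simp_all flip: e)
      ultimately show "norm (pcoeff q i * dpcoeff q v (n - i) + dpcoeff q v i * pcoeff q (n - i)) \<le> 2 * ?B"
        using norm_triangle_ineq order_trans by (smt (verit))
    qed
    also have "\<dots> = real (n - 7) * (2 * ?B)"
      using 5 by simp
    finally have "norm (dpcoeff q v n) \<le> 6 * (real (n - 7) * (2 * ?B)) / (real (n + 1) * real (n - 6))"
      unfolding dpcoeff_rec[OF 5] norm_divide norm_mult norm_of_nat
      by (intro divide_right_mono) (auto simp: mult_ac)
    also have "\<dots> = ?B * (12 * real (n - 7) / (real (n + 1) * real (n - 6)))"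
      by simp
    also have "12 * real (n - 7) \<le> real (n + 1) * real (n - 6)"
    proof -
      \<comment> \<open>The difference of the two sides is
        \<open>(n - 17/2)^2 + 23/4\<close>.\<close>
      have "0 \<le> (real n - 17/2)\<^sup>2" by simp
      then show ?thesis
        using 5 by (simp add: of_nat_diff power2_eq_square algebra_simps)
    qed
    then have "?B * (12 * real (n - 7) / (real (n + 1) * real (n - 6))) \<le> ?B * 1"
      using 5 by (intro mult_left_mono) (simp_all add: divide_le_eq)
    finally show ?thesis by simp
  qed (use comp norm_ge_zero[of v] in \<open>auto simp: dpcoeff_base norm_divide power_divide simp del: norm_ge_zero\<close>)
qed

lemma C1_holo_pcoeff: "C1_holo (\<lambda>q. pcoeff q n) (\<lambda>q v. dpcoeff q v n) S"
proof (induction n rule: less_induct)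
  case (less n)
  show ?case
  proof (cases rule: weight_cases[of n])
    case 1
    then have "(\<lambda>q. pcoeff q n) = (\<lambda>q. if n = 0 then 1 else 0)"
      by (auto simp: pcoeff_base pcoeff_small)
    then show ?thesis
      using 1 by (simp add: dpcoeff_base C1_holo_const)
  next
    case 2
    then show ?thesis
      using C1_holo_mult[OF C1_holo_const[of "-1/10"] C1_holo_coords(1)]
      by (simp add: pcoeff_base dpcoeff_base)
  next
    case 3
    then show ?thesis
      using C1_holo_mult[OF C1_holo_const[of "1/6"] C1_holo_coords(2)]
      by (simp add: pcoeff_base dpcoeff_base)
  next
    case 4
    then show ?thesis
      by (simp add: pcoeff_base dpcoeff_base C1_holo_coords)
  next
    case 5
    let ?d = "of_nat (n + 1) * of_nat (n - 6) :: complex"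
    have "C1_holo (\<lambda>q. \<Sum>i=4..n-4. pcoeff q i * pcoeff q (n - i))
      (\<lambda>q v. \<Sum>i=4..n-4. pcoeff q i * dpcoeff q v (n - i) + dpcoeff q v i * pcoeff q (n - i)) S"
      using 5 by (intro C1_holo_sum C1_holo_mult less.IH) auto
    from C1_holo_mult[OF C1_holo_const[of "6 / ?d"] this] show ?thesis
      by (simp add: pcoeff_rec[OF 5] dpcoeff_rec[OF 5])
  qed
qed

text \<open>The polynomial \<open>pcoeff q n\<close> is weighted homogeneous of degree \<open>n\<close>, so this is Euler's identity.\<close>

definition euler :: "complex3 \<Rightarrow> complex3" where
  "euler q = (4 * fst q, 5 * fst (snd q), 6 * snd (snd q))"

lemma dpcoeff_euler: "dpcoeff q (euler q) n = of_nat n * pcoeff q n"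
proof (induction n rule: less_induct)
  case (less n)
  show ?case
  proof (cases rule: weight_cases[of n])
    case 1
    then show ?thesis by (cases "n = 0") (simp_all add: dpcoeff_base pcoeff_small)
  next
    case 5
    have "(\<Sum>i=4..n-4. pcoeff q i * dpcoeff q (euler q) (n - i) + dpcoeff q (euler q) i * pcoeff q (n - i))
        = (\<Sum>i=4..n-4. of_nat n * (pcoeff q i * pcoeff q (n - i)))"
    proof (rule sum.cong[OF refl])
      fix i assume i: "i \<in> {4..n-4}"
      then have in': "i \<le> n" by auto
      from in' have n: "(of_nat n :: complex) = of_nat i + of_nat (n - i)"
        by (simp flip: of_nat_add)
      show "pcoeff q i * dpcoeff q (euler q) (n - i) + dpcoeff q (euler q) i * pcoeff q (n - i)
        = of_nat n * (pcoeff q i * pcoeff q (n - i))"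
      proof -
        have "i < n" "n - i < n" using i 5 by simp_all linarith
        then show ?thesis
          unfolding n by (simp add: less.IH algebra_simps)
      qed
    qed
    then show ?thesis
      by (simp add: pcoeff_rec[OF 5] dpcoeff_rec[OF 5] flip: sum_distrib_left)
  qed (simp_all add: pcoeff_base dpcoeff_base euler_def)
qed

text \<open>Coefficient comparison in \<open>y'' = 6 y^2 + z\<close>. The source is
  \<open>\<zeta>^4 z = a - b\<close>, because \<open>z = z0 - \<zeta>\<close>; this explains the
  terms at \<open>n = 4\<close> and \<open>n = 5\<close>. At \<open>n = 6\<close> both sides are 12
  times the free coefficient.\<close>

lemma pcoeff_ode:
  "(of_nat n - 2) * (of_nat n - 3) * pcoeff q n =
     6 * (\<Sum>i\<le>n. pcoeff q i * pcoeff q (n - i)) +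
     (if n = 4 then fst q else 0) - (if n = 5 then fst (snd q) else 0)"
proof (cases "n \<ge> 7")
  case True
  \<comment> \<open>Coefficients 1, 2 and 3 vanish, so apart from the two end terms only the range
    \<open>4..n-4\<close> survives.\<close>
  have "(\<Sum>i\<le>n. pcoeff q i * pcoeff q (n - i)) =
    (\<Sum>i\<in>{0, n} \<union> {4..n-4}. pcoeff q i * pcoeff q (n - i))"
  proof (rule sum.mono_neutral_right)
    show "\<forall>i\<in>{..n} - ({0, n} \<union> {4..n-4}). pcoeff q i * pcoeff q (n - i) = 0"
    proof
      fix i assume "i \<in> {..n} - ({0, n} \<union> {4..n-4})"
      then have "0 < i \<and> i < 4 \<or> 0 < n - i \<and> n - i < 4" by auto
      then show "pcoeff q i * pcoeff q (n - i) = 0" by (auto simp: pcoeff_small)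
    qed
  qed (use True in auto)
  also have "\<dots> = 2 * pcoeff q n + (\<Sum>i=4..n-4. pcoeff q i * pcoeff q (n - i))"
    using True by (subst sum.union_disjoint) (auto simp: pcoeff_base)
  finally have 1: "(\<Sum>i\<le>n. pcoeff q i * pcoeff q (n - i)) =
    2 * pcoeff q n + (\<Sum>i=4..n-4. pcoeff q i * pcoeff q (n - i))" .
  have "of_nat (n + 1) * of_nat (n - 6) * pcoeff q n = 6 * (\<Sum>i=4..n-4. pcoeff q i * pcoeff q (n - i))"
    using True of_nat_eq_iff[of n 6, where 'a = complex]
    by (simp add: pcoeff_rec[OF True] del: of_nat_Suc)
  then have "(of_nat n + 1) * (of_nat n - 6) * pcoeff q n = 6 * (\<Sum>i=4..n-4. pcoeff q i * pcoeff q (n - i))"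
    using True by (simp add: of_nat_diff add.commute)
  then show ?thesis
    using True unfolding 1 by (simp add: algebra_simps)
next
  case False
  then consider "n = 0" | "n = Suc 0" | "n = 2" | "n = 3" | "n = 4" | "n = 5" | "n = 6" by linarith
  then show ?thesis
    by cases (simp_all add: pcoeff_base atMost_Suc atMost_nat_numeral)
qed

section \<open>The summed series, their derivatives, and the equation along the Euler field\<close>

definition gser :: "complex3 \<Rightarrow> complex" where
  "gser q = (\<Sum>n. pcoeff q n)"

definition dgser :: "complex3 \<Rightarrow> complex3 \<Rightarrow> complex" where
  "dgser q v = (\<Sum>n. dpcoeff q v n)"

text \<open>The derivative \<open>x = dy/dz = - dy/d\<zeta>\<close> is \<open>\<zeta>\<^bsup>-3\<^esup> hser q\<close>.\<close>

definition hser :: "complex3 \<Rightarrow> complex" where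
  "hser q = (\<Sum>n. (2 - of_nat n) * pcoeff q n)"

definition dhser :: "complex3 \<Rightarrow> complex3 \<Rightarrow> complex" where
  "dhser q v = (\<Sum>n. (2 - of_nat n) * dpcoeff q v n)"

text \<open>The constant is \<open>2 * 64\<close>: the weight \<open>2 - n\<close> has norm at most
  \<open>2 (n + 1)\<close>, and \<open>64\<close> comes from the bound on \<open>dpcoeff\<close>, so
  values and derivatives share this majorant.\<close>

lemma summable_majorant: "summable (\<lambda>n. 128 * (of_nat (Suc n) * (1/2) ^ n) :: real)"
  using sums_summable[OF geometric_deriv_sums[of "1/2::real"]] by (intro summable_mult) simp

lemma norm_weighted_pcoeff_le:
  assumes "q \<in> polydisc"
  shows "norm ((2 - of_nat n) * pcoeff q n) \<le> 128 * (of_nat (Suc n) * (1/2) ^ n)"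
    "norm ((2 - of_nat n) * dpcoeff q v n) \<le> 128 * (of_nat (Suc n) * (1/2) ^ n) * norm v"
proof -
  have n: "norm (2 - of_nat n :: complex) \<le> 2 * of_nat (Suc n)"
    using norm_triangle_ineq4[of "2 :: complex" "of_nat n"] by simp
  have "norm ((2 - of_nat n) * pcoeff q n) \<le> (2 * of_nat (Suc n)) * (1/2) ^ n"
    unfolding norm_mult by (intro mult_mono n norm_pcoeff_le[OF assms]) auto
  also have "\<dots> \<le> (128 * of_nat (Suc n)) * (1/2) ^ n"
    by (intro mult_right_mono) auto
  finally show "norm ((2 - of_nat n) * pcoeff q n) \<le> 128 * (of_nat (Suc n) * (1/2) ^ n)"
    by (simp only: mult.assoc)
  have "norm ((2 - of_nat n) * dpcoeff q v n) \<le> (2 * of_nat (Suc n)) * (64 * (1/2) ^ n * norm v)"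
    unfolding norm_mult by (intro mult_mono n norm_dpcoeff_le[OF assms]) auto
  then show "norm ((2 - of_nat n) * dpcoeff q v n) \<le> 128 * (of_nat (Suc n) * (1/2) ^ n) * norm v"
    by (simp only: mult_ac)
qed

lemma C1_holo_hser: "C1_holo hser dhser polydisc"
  unfolding hser_def[abs_def] dhser_def[abs_def]
proof (rule C1_holo_series)
  show "C1_holo (\<lambda>q. (2 - of_nat n) * pcoeff q n) (\<lambda>q v. (2 - of_nat n) * dpcoeff q v n) polydisc" for n
    using C1_holo_mult[OF C1_holo_const C1_holo_pcoeff, of "2 - of_nat n"] by simp
  show "norm ((2 - of_nat n) * pcoeff q n) \<le> 128 * (of_nat (Suc n) * (1/2) ^ n)"
    "norm ((2 - of_nat n) * dpcoeff q v n) \<le> 128 * (of_nat (Suc n) * (1/2) ^ n) * norm v"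
    if "q \<in> polydisc" for n q v
    using norm_weighted_pcoeff_le[OF that] by blast+
qed (use polydisc summable_majorant in blast)+

lemma C1_holo_gser: "C1_holo gser dgser polydisc"
  unfolding gser_def[abs_def] dgser_def[abs_def]
proof (rule C1_holo_series)
  show "summable (\<lambda>n. 64 * (1/2) ^ n :: real)"
    by (intro summable_mult summable_geometric) simp
  show "norm (pcoeff q n) \<le> 64 * (1/2) ^ n" if "q \<in> polydisc" for n q
    using norm_pcoeff_le[OF that, of n] by (rule order_trans) simp
qed (use polydisc norm_dpcoeff_le C1_holo_pcoeff in auto)

lemma summable_pcoeff:
  assumes "q \<in> polydisc"
  shows "summable (\<lambda>n. norm (pcoeff q n))" "summable (pcoeff q)"
    "summable (\<lambda>n. (2 - of_nat n) * pcoeff q n)"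
proof -
  show "summable (\<lambda>n. norm (pcoeff q n))"
    by (rule summable_comparison_test'[OF summable_geometric[of "1/2::real"], of 0])
      (use norm_pcoeff_le[OF assms] in auto)
  then show "summable (pcoeff q)"
    by (rule summable_norm_cancel)
  show "summable (\<lambda>n. (2 - of_nat n) * pcoeff q n)"
    using norm_weighted_pcoeff_le(1)[OF assms] by (rule summable_comparison_test'[OF summable_majorant])
qed

text \<open>After the constant term the series starts at weight 4, so the tail is at most
  \<open>(1/2)^4 * 2\<close>. This confines \<open>gser\<close> to the right half plane, where
  \<open>csqrt\<close> is holomorphic.\<close>

lemma norm_gser_le:
  assumes "q \<in> polydisc"
  shows "norm (gser q - 1) \<le> 1/8"
proof -
  note s = summable_pcoeff(1)[OF assms]
  have "gser q - 1 = (\<Sum>n. pcoeff q (n + 4))"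
    using suminf_split_initial_segment[OF summable_pcoeff(2)[OF assms], of 4]
    by (simp add: gser_def lessThan_nat_numeral lessThan_Suc pcoeff_base)
  also have "norm \<dots> \<le> (\<Sum>n. norm (pcoeff q (n + 4)))"
    by (rule summable_norm[OF summable_ignore_initial_segment[OF s]])
  also have "\<dots> \<le> (\<Sum>n. (1/2) ^ 4 * (1/2) ^ n)"
  proof (rule suminf_le)
    show "norm (pcoeff q (n + 4)) \<le> (1/2) ^ 4 * (1/2) ^ n" for n
      using norm_pcoeff_le[OF assms, of "n + 4"] by (simp add: power_add mult.commute)
  qed (intro summable_ignore_initial_segment s summable_mult summable_geometric; simp)+
  also have "\<dots> = (1/2) ^ 4 * (1 / (1 - 1/2 :: real))"
    by (subst suminf_mult) (simp_all add: summable_geometric suminf_geometric)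
  finally show ?thesis by (simp add: power_divide)
qed

text \<open>At the origin all coefficients of positive weight vanish. The quadratic terms of the
  differentiated recursion therefore drop out, leaving only the linear contributions of weights 4, 5
  and 6.\<close>

lemma gser_hser_zero:
  "gser 0 = 1" "hser 0 = 2" "dgser 0 v = - fst v / 10 + fst (snd v) / 6 + snd (snd v)"
  "dhser 0 v = fst v / 5 - fst (snd v) / 2 - 4 * snd (snd v)"
proof -
  have p: "pcoeff 0 n = 0" if "n > 0" for n
    using that
  proof (induction n rule: less_induct)
    case (less n)
    show ?case
    proof (cases "n \<ge> 7")
      case True
      have "(\<Sum>i=4..n-4. pcoeff 0 i * pcoeff 0 (n - i)) = 0"
        using True by (intro sum.neutral) (auto simp: less.IH)
      then show ?thesis by (simp add: pcoeff_rec[OF True])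
    qed (use less.prems in \<open>subst pcoeff.simps; simp\<close>)
  qed
  have dp: "dpcoeff 0 v n = 0" if "n \<ge> 7" for n
  proof -
    have "(\<Sum>i=4..n-4. pcoeff 0 i * dpcoeff 0 v (n - i) + dpcoeff 0 v i * pcoeff 0 (n - i)) = 0"
      using that by (intro sum.neutral) (auto simp: p)
    then show ?thesis by (simp add: dpcoeff_rec[OF that])
  qed
  show "gser 0 = 1" "hser 0 = 2"
    unfolding gser_def hser_def by (subst suminf_finite[of "{0}"]; simp add: p pcoeff_base)+
  have "dgser 0 v = (\<Sum>n<7. dpcoeff 0 v n)" "dhser 0 v = (\<Sum>n<7. (2 - of_nat n) * dpcoeff 0 v n)"
    unfolding dgser_def dhser_def by (rule suminf_finite; simp add: dp)+
  then show "dgser 0 v = - fst v / 10 + fst (snd v) / 6 + snd (snd v)"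
    "dhser 0 v = fst v / 5 - fst (snd v) / 2 - 4 * snd (snd v)"
    by (simp_all add: lessThan_nat_numeral lessThan_Suc dpcoeff_base)
qed

lemma dgser_euler:
  assumes "q \<in> polydisc"
  shows "dgser q (euler q) = 2 * gser q - hser q"
proof -
  have "(\<lambda>n. 2 * pcoeff q n - (2 - of_nat n) * pcoeff q n) sums (2 * gser q - hser q)"
    unfolding gser_def hser_def
    by (intro sums_diff sums_mult summable_sums summable_pcoeff[OF assms])
  then show ?thesis
    by (simp add: dgser_def dpcoeff_euler sums_iff algebra_simps)
qed

text \<open>Write \<open>n (2 - n) = 3 (2 - n) - (n - 2) (n - 3)\<close> and sum
  \<open>pcoeff_ode\<close>; the Cauchy product yields the square. Together with
  \<open>dgser_euler\<close> this is the second order equation as a first order system.\<close>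

lemma dhser_euler:
  assumes "q \<in> polydisc"
  shows "dhser q (euler q) = 3 * hser q - 6 * (gser q)\<^sup>2 - fst q + fst (snd q)"
proof -
  have "(\<lambda>n. \<Sum>i\<le>n. pcoeff q i * pcoeff q (n - i)) sums (gser q * gser q)"
    unfolding gser_def by (rule Cauchy_product_sums) (use summable_pcoeff[OF assms] in auto)
  then have "(\<lambda>n. 3 * ((2 - of_nat n) * pcoeff q n) -
      (6 * (\<Sum>i\<le>n. pcoeff q i * pcoeff q (n - i)) + (if n = 4 then fst q else 0)
        - (if n = 5 then fst (snd q) else 0)))
    sums (3 * hser q - (6 * (gser q * gser q) + fst q - fst (snd q)))"
    unfolding hser_def
    by (intro sums_diff sums_add sums_mult summable_sums summable_pcoeff[OF assms] sums_single)
  then show ?thesis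
    unfolding pcoeff_ode[symmetric]
    by (simp add: dhser_def dpcoeff_euler sums_iff algebra_simps power2_eq_square)
qed

text \<open>The equation has a regular singular point at 0. The operator multiplies the coefficient
  of \<open>w^n\<close> by \<open>1 + m n\<close>; dividing by this factor, of norm at least 1,
  keeps the radius of convergence.\<close>

lemma euler_ode_solution:
  assumes f: "f holomorphic_on ball 0 r"
  obtains k where "k holomorphic_on ball 0 r"
    "\<And>w. w \<in> ball 0 r \<Longrightarrow> k w + of_nat m * w * deriv k w = f w" "k 0 = f 0"
proof -
  define a where "a = (\<lambda>n. (deriv ^^ n) f 0 / fact n)"
  define b where "b = (\<lambda>n. a n / (1 + of_nat m * of_nat n))"
  define k where "k = (\<lambda>w. \<Sum>n. b n * w ^ n)"
  have ba: "b n * (1 + of_nat m * of_nat n) = a n" for n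
    unfolding b_def by (metis nonzero_eq_divide_eq of_nat_1 of_nat_Suc of_nat_mult of_nat_neq_0 times_divide_eq_left plus_1_eq_Suc add.commute mult.commute)
  have fa: "(\<lambda>n. a n * w ^ n) sums f w" if "w \<in> ball 0 r" for w
    using holomorphic_power_series[OF f that] by (simp add: a_def)
  have sb: "summable (\<lambda>n. b n * w ^ n)" if w: "norm w < r" for w
  proof -
    \<comment> \<open>Absolute convergence at \<open>w\<close> follows from convergence at a point
      of strictly larger modulus.\<close>
    obtain s where s: "norm w < s" "s < r" using w dense by blast
    have "summable (\<lambda>n. a n * of_real s ^ n)"
      using fa[of "of_real s"] s norm_ge_zero[of w] by (simp add: sums_iff)
    then have *: "summable (\<lambda>n. norm (a n * w ^ n))"
      by (rule powser_insidea) (use s norm_ge_zero[of w] in simp)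
    have "norm (b n * w ^ n) \<le> norm (a n * w ^ n)" for n
    proof -
      have "norm (b n) * 1 \<le> norm (b n) * norm (1 + of_nat m * of_nat n :: complex)"
        by (intro mult_left_mono) (metis le_add1 norm_of_nat of_nat_1 of_nat_add of_nat_le_iff of_nat_mult, simp)
      then show ?thesis
        by (simp add: norm_mult ba[of n, symmetric] mult_right_mono)
    qed
    then show ?thesis
      by (rule summable_comparison_test'[OF *])
  qed
  have kb: "(\<lambda>n. b n * w ^ n) sums k w" if "w \<in> ball 0 r" for w
    unfolding k_def by (rule summable_sums[OF sb]) (use that in simp)
  have hol: "k holomorphic_on ball 0 r"
    by (rule power_series_holomorphic[where a = b]) (use kb in simp)
  moreover have "k w + of_nat m * w * deriv k w = f w" if w: "w \<in> ball 0 r" for w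
  proof -
    have w': "norm w < r" using w by simp
    have "(k has_field_derivative (\<Sum>n. diffs b n * w ^ n)) (at w)"
      unfolding k_def by (rule termdiffs_strong'[of r]) (use sb w' in auto)
    then have dk: "deriv k w = (\<Sum>n. diffs b n * w ^ n)"
      by (rule DERIV_imp_deriv)
    have "summable (\<lambda>n. diffs b n * w ^ n)"
      by (rule termdiff_converges[OF w']) (use sb in simp)
    from diffs_equiv[OF this] have "(\<lambda>n. of_nat n * b n * w ^ (n - Suc 0)) sums deriv k w"
      by (simp add: dk)
    from sums_mult[OF this, of w]
    have "(\<lambda>n. w * (of_nat n * b n * w ^ (n - Suc 0))) sums (w * deriv k w)" .
    moreover have "w * (of_nat n * b n * w ^ (n - Suc 0)) = of_nat n * b n * w ^ n" for n
      by (cases n) simp_all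
    ultimately have "(\<lambda>n. of_nat n * b n * w ^ n) sums (w * deriv k w)"
      by simp
    from sums_add[OF kb[OF w] sums_mult[OF this, of "of_nat m"]]
    have "(\<lambda>n. a n * w ^ n) sums (k w + of_nat m * (w * deriv k w))"
      by (simp add: ba[symmetric] algebra_simps)
    then show ?thesis
      using sums_unique2[OF fa[OF w]] by (simp add: mult.assoc)
  qed
  moreover have "k 0 = f 0"
    unfolding k_def powser_zero by (simp add: b_def a_def)
  ultimately show ?thesis using that by blast
qed

section \<open>The two charts\<close>

definition groot :: "complex3 \<Rightarrow> complex" where
  "groot q = csqrt (gser q)"

definition dgroot :: "complex3 \<Rightarrow> complex3 \<Rightarrow> complex" where
  "dgroot q v = 1 / (2 * csqrt (gser q)) * dgser q v"

lemma Re_pos_not_nonpos: "Re w > 0 \<Longrightarrow> w \<notin> \<real>\<^sub>\<le>\<^sub>0"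
  by (auto simp: complex_nonpos_Reals_iff)

lemma Re_csqrt_pos:
  assumes "Re w > 0"
  shows "Re (csqrt w) > 0"
proof (rule ccontr)
  assume "\<not> Re (csqrt w) > 0"
  then have "Re (csqrt w) = 0"
    using Re_csqrt[of w] by linarith
  then have "Re ((csqrt w)\<^sup>2) \<le> 0"
    by (simp add: power2_eq_square)
  then show False using assms by simp
qed

lemma gser_bounds:
  assumes "q \<in> polydisc"
  shows "Re (gser q) > 0" "norm (gser q) \<ge> 7/8"
proof -
  have "\<bar>Re (gser q - 1)\<bar> \<le> 1/8"
    using norm_gser_le[OF assms] abs_Re_le_cmod order_trans by blast
  then show "Re (gser q) > 0" unfolding abs_le_iff by simp
  show "norm (gser q) \<ge> 7/8"
    using norm_gser_le[OF assms] norm_triangle_ineq2[of 1 "gser q"] by (simp add: norm_minus_commute)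
qed

lemma groot:
  assumes "q \<in> polydisc"
  shows "groot q ^ 2 = gser q" "groot q \<noteq> 0"
  using gser_bounds(1)[OF assms] by (auto simp: groot_def)

lemma C1_holo_groot: "C1_holo groot dgroot polydisc"
  unfolding groot_def[abs_def] dgroot_def[abs_def]
  by (rule C1_holo_compose[OF C1_holo_gser, of "{w. Re w > 0}"])
    (use gser_bounds(1) in \<open>auto intro!: has_field_derivative_csqrt[unfolded inverse_eq_divide]
        Re_pos_not_nonpos open_halfspace_Re_gt\<close>)

lemma dgroot_euler:
  assumes "q \<in> polydisc"
  shows "dgroot q (euler q) = groot q - hser q / (2 * groot q)"
  using groot[OF assms]
  by (simp add: dgroot_def dgser_euler[OF assms] groot_def[symmetric] field_simps power2_eq_square)

lemma dgroot_zero: "groot 0 = 1" "dgroot 0 v = dgser 0 v / 2"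
  by (simp_all add: groot_def dgroot_def gser_hser_zero)

text \<open>Since \<open>y\<^bsup>1/2\<^esup> = groot q / \<zeta>\<close>, the factor \<open>1 / groot q ^ n\<close> replaces the unit \<open>\<zeta>\<^sup>n\<close> of a quantity of
  weight \<open>n\<close> by \<open>y\<^bsup>-n/2\<^esup>\<close>.\<close>

definition scaled :: "(complex3 \<Rightarrow> complex) \<Rightarrow> nat \<Rightarrow> complex3 \<Rightarrow> complex" where
  "scaled f n q = f q / groot q ^ n"

definition dscaled :: "(complex3 \<Rightarrow> complex) \<Rightarrow> (complex3 \<Rightarrow> complex3 \<Rightarrow> complex) \<Rightarrow> nat \<Rightarrow>
    complex3 \<Rightarrow> complex3 \<Rightarrow> complex" where
  "dscaled f f' n q v = f' q v / groot q ^ n - of_nat n * f q * dgroot q v / groot q ^ Suc n"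

lemma C1_holo_scaled:
  assumes "C1_holo f f' polydisc"
  shows "C1_holo (scaled f n) (dscaled f f' n) polydisc"
  unfolding scaled_def[abs_def] dscaled_def[abs_def]
  by (rule C1_holo_divide_power[OF assms C1_holo_groot groot(2)])

lemma euler_coords:
  "fst (euler q) = 4 * fst q" "fst (snd (euler q)) = 5 * fst (snd q)" "snd (snd (euler q)) = 6 * snd (snd q)"
  by (simp_all add: euler_def)

text \<open>The factor \<open>- groot q\<close> is pulled out so that each component takes the shape
  of the vector field of the equation; the last term comes from differentiating the power of
  \<open>groot\<close>.\<close>

lemma dscaled_euler:
  assumes "q \<in> polydisc"
  shows "dscaled f f' n q (euler q) =
    - groot q * (of_nat n * f q / groot q ^ Suc n - f' q (euler q) / groot q ^ Suc n
      - of_nat n / 2 * scaled hser 3 q * scaled f n q)"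
proof -
  define R where "R = groot q"
  have R: "R \<noteq> 0" using groot[OF assms] by (simp add: R_def)
  have "(f' / R ^ n - of_nat n * g * (R - h / (2 * R)) / R ^ Suc n) =
    - R * (of_nat n * g / R ^ Suc n - f' / R ^ Suc n - of_nat n / 2 * (h / R ^ 3) * (g / R ^ n))"
    for f' g h
    using R by (simp add: field_simps power2_eq_square power3_eq_cube)
  then show ?thesis
    by (simp add: dscaled_def scaled_def dgroot_euler[OF assms] flip: R_def)
qed

text \<open>These are \<open>x y^(-3/2)\<close>, \<open>z y^(-2)\<close> and \<open>y^(-5/2)\<close>
  in terms of \<open>(a, b, c)\<close>: the middle entry uses \<open>\<zeta>^4 z = a - b\<close>,
  the last one \<open>b = \<zeta>^5\<close>.\<close>

definition painleve_chart :: "complex3 \<Rightarrow> complex3" where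
  "painleve_chart q =
     (scaled hser 3 q, scaled (\<lambda>q. fst q - fst (snd q)) 4 q, scaled (\<lambda>q. fst (snd q)) 5 q)"

definition dpainleve_chart :: "complex3 \<Rightarrow> complex3 \<Rightarrow> complex3" where
  "dpainleve_chart q v =
     (dscaled hser dhser 3 q v, dscaled (\<lambda>q. fst q - fst (snd q)) (\<lambda>_ v. fst v - fst (snd v)) 4 q v,
      dscaled (\<lambda>q. fst (snd q)) (\<lambda>_ v. fst (snd v)) 5 q v)"

lemma C1_holo_map_painleve_chart: "C1_holo_map painleve_chart dpainleve_chart polydisc"
  unfolding C1_holo_map_def painleve_chart_def dpainleve_chart_def fst_conv snd_conv
  by (intro conjI C1_holo_scaled C1_holo_hser C1_holo_coords C1_holo_diff)

text \<open>The first Painleve equation in the chart, divided by \<open>s = y\<^bsup>1/2\<^esup>\<close>.\<close>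

definition painleve_field :: "complex3 \<Rightarrow> complex3" where
  "painleve_field p = (case p of (X, Z, e) \<Rightarrow> (6 + Z - 3/2 * X\<^sup>2, e - 2 * X * Z, - 5/2 * X * e))"

text \<open>Along a solution \<open>d\<zeta>/dz = -1\<close>, so \<open>q\<close> has velocity
  \<open>- euler q / \<zeta>\<close>, while \<open>s = groot q / \<zeta>\<close>. Hence, per unit of
  \<open>s\<close>, the Painleve field is the image of \<open>- euler q / groot q\<close>.\<close>

lemma dpainleve_chart_euler:
  assumes q: "q \<in> polydisc"
  shows "dpainleve_chart q (euler q) = cscale (- groot q) (painleve_field (painleve_chart q))"
proof -
  let ?a = "fst q" and ?b = "fst (snd q)" and ?X = "scaled hser 3 q"
  have R: "groot q \<noteq> 0" "gser q = groot q ^ 2"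
    using groot[OF q] by auto
  have "3 * hser q / groot q ^ 4 - dhser q (euler q) / groot q ^ 4 = 6 + (?a - ?b) / groot q ^ 4"
    using R(1) by (simp add: dhser_euler[OF q] R(2) diff_divide_distrib add_divide_distrib flip: power_mult)
  then have X: "dscaled hser dhser 3 q (euler q) =
      - groot q * (6 + scaled (\<lambda>q. fst q - fst (snd q)) 4 q - 3/2 * ?X\<^sup>2)"
    by (simp add: dscaled_euler[OF q] power2_eq_square scaled_def[of "\<lambda>q. fst q - fst (snd q)"])
  have "4 * (?a - ?b) / groot q ^ 5 - (4 * ?a - 5 * ?b) / groot q ^ 5 = ?b / groot q ^ 5"
    by (simp flip: diff_divide_distrib)
  then have Z: "dscaled (\<lambda>q. fst q - fst (snd q)) (\<lambda>_ v. fst v - fst (snd v)) 4 q (euler q) =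
      - groot q * (scaled (\<lambda>q. fst (snd q)) 5 q - 2 * ?X * scaled (\<lambda>q. fst q - fst (snd q)) 4 q)"
    by (simp add: dscaled_euler[OF q] euler_coords scaled_def algebra_simps)
  have e: "dscaled (\<lambda>q. fst (snd q)) (\<lambda>_ v. fst (snd v)) 5 q (euler q) =
      - groot q * (- 5/2 * ?X * scaled (\<lambda>q. fst (snd q)) 5 q)"
    by (simp add: dscaled_euler[OF q] euler_coords)
  show ?thesis
    by (simp only: dpainleve_chart_def X Z e painleve_field_def painleve_chart_def cscale_def
        prod.case fst_conv snd_conv)
qed

text \<open>This is \<open>h y^(-3)\<close>, because \<open>c = h \<zeta>^6\<close>.\<close>

definition reduced_h :: "complex3 \<Rightarrow> complex" where
  "reduced_h = scaled (\<lambda>q. snd (snd q)) 6"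

lemma norm_reduced_h:
  assumes "q \<in> polydisc"
  shows "norm (reduced_h q) < 1"
proof -
  have "norm (groot q ^ 6) = norm (gser q) ^ 3"
    unfolding groot(1)[OF assms, symmetric] by (simp add: norm_power flip: power_mult)
  moreover have "norm (gser q) ^ 3 \<ge> (7/8) ^ 3"
    using gser_bounds(2)[OF assms] by (intro power_mono) auto
  moreover have "norm (snd (snd q)) < 1/64"
    using assms by (auto simp: polydisc_def)
  moreover have "(1/64 :: real) < (7/8) ^ 3"
    by (simp add: power_divide)
  ultimately have "norm (snd (snd q)) < norm (groot q ^ 6)" by linarith
  then show ?thesis
    using groot(2)[OF assms] by (simp add: reduced_h_def scaled_def norm_divide divide_less_eq)
qed

lemma Re_one_plus_reduced_h: "q \<in> polydisc \<Longrightarrow> Re (1 + reduced_h q) > 0"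
  using norm_reduced_h[of q] abs_Re_le_cmod[of "reduced_h q"] by simp

text \<open>The quadrature \<open>dz = dy/x\<close> with \<open>x\<^sup>2 = 4 y\<^sup>3 + 4 h\<close> is solved by \<open>z = z\<^sub>0 - k(h y\<^bsup>-3\<^esup>) y\<^bsup>-1/2\<^esup>\<close> when
  \<open>k(w) + 6 w k'(w) = (1 + w)\<^bsup>-1/2\<^esup>\<close>.\<close>

definition elliptic_chart :: "(complex \<Rightarrow> complex) \<Rightarrow> complex3 \<Rightarrow> complex3" where
  "elliptic_chart k q =
     (2 * csqrt (1 + reduced_h q),
      scaled fst 4 q - scaled (\<lambda>q. fst (snd q)) 5 q * k (reduced_h q),
      scaled (\<lambda>q. fst (snd q)) 5 q)"

text \<open>The common shape of the inverse derivatives of both charts at the origin: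
  \<open>b\<close> is the last component, \<open>a\<close> the sum of the last two (their middle
  component is \<open>a - b\<close>), and \<open>c\<close> a linear combination of all
  three.\<close>

lemma bounded_linear_swap:
  "bounded_linear (\<lambda>p::complex3. (fst (snd p) + snd (snd p), snd (snd p), c * fst (snd p) + d * snd (snd p) + e * fst p))"
  by (intro linear_conv_bounded_linear[THEN iffD1] linearI) (auto simp: algebra_simps scaleR_conv_of_real)

lemma dscaled_zero:
  "dscaled f f' n 0 v = f' 0 v - of_nat n * f 0 * dgser 0 v / 2"
  by (simp add: dscaled_def dgroot_zero)

lemma painleve_chart_zero: "painleve_chart 0 = (2, 0, 0)"
  by (simp add: painleve_chart_def scaled_def gser_hser_zero dgroot_zero)

lemma holo_chart_painleve:
  obtains U V \<Psi> where "holo_chart painleve_chart dpainleve_chart U V \<Psi>" "U \<subseteq> polydisc" "0 \<in> U"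
\<comment> \<open>At the origin the first component has derivative \<open>a/2 - b - 7 c\<close>.
  Solving for \<open>c\<close> with \<open>a = Z + e\<close> and \<open>b = e\<close> gives
  \<open>Z/14 - e/14 - X/7\<close>.\<close>
proof (rule holo_chart_inverse_function[OF C1_holo_map_painleve_chart polydisc(2,3)
      bounded_linear_swap[of "1/14" "-1/14" "-1/7"]])
  fix v :: complex3
  show "(fst (snd (dpainleve_chart 0 v)) + snd (snd (dpainleve_chart 0 v)), snd (snd (dpainleve_chart 0 v)),
      1/14 * fst (snd (dpainleve_chart 0 v)) + - 1/14 * snd (snd (dpainleve_chart 0 v))
        + - 1/7 * fst (dpainleve_chart 0 v)) = v"
    by (simp add: dpainleve_chart_def dscaled_zero gser_hser_zero prod_eq_iff field_simps)
qed

lemma holo_chart_elliptic: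
  assumes k: "k holomorphic_on ball 0 1" "k 0 = 1"
  obtains \<Theta>' U V \<Psi> where "holo_chart (elliptic_chart k) \<Theta>' U V \<Psi>" "U \<subseteq> polydisc" "0 \<in> U"
proof -
  let ?c = "\<lambda>q::complex3. snd (snd q)"
  let ?w' = "dscaled ?c (\<lambda>_. ?c) 6"
  let ?b = "scaled (\<lambda>q. fst (snd q)) 5" and ?b' = "dscaled (\<lambda>q. fst (snd q)) (\<lambda>_ v. fst (snd v)) 5"
  define \<Theta>' where "\<Theta>' = (\<lambda>q v.
    (2 * (1 / (2 * csqrt (1 + reduced_h q)) * ?w' q v),
     dscaled fst (\<lambda>_. fst) 4 q v - (?b q * (deriv k (reduced_h q) * ?w' q v) + ?b' q v * k (reduced_h q)),
     ?b' q v))"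
  have w: "C1_holo reduced_h ?w' polydisc"
    unfolding reduced_h_def by (intro C1_holo_scaled C1_holo_coords)
  have "C1_holo (\<lambda>q. csqrt (1 + reduced_h q)) (\<lambda>q v. 1 / (2 * csqrt (1 + reduced_h q)) * ?w' q v) polydisc"
  proof (rule C1_holo_compose[of "\<lambda>q. 1 + reduced_h q", where T = "{w. Re w > 0}"])
    show "C1_holo (\<lambda>q. 1 + reduced_h q) ?w' polydisc"
      using C1_holo_add[OF C1_holo_const w] by simp
  qed (use Re_one_plus_reduced_h in \<open>auto intro!: has_field_derivative_csqrt[unfolded inverse_eq_divide]
        Re_pos_not_nonpos open_halfspace_Re_gt\<close>)
  from C1_holo_mult[OF C1_holo_const[of 2] this]
  have 1: "C1_holo (\<lambda>q. 2 * csqrt (1 + reduced_h q))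
      (\<lambda>q v. 2 * (1 / (2 * csqrt (1 + reduced_h q)) * ?w' q v)) polydisc" by simp
  have 2: "C1_holo (\<lambda>q. k (reduced_h q)) (\<lambda>q v. deriv k (reduced_h q) * ?w' q v) polydisc"
    by (rule C1_holo_compose[OF w, of "ball 0 1"])
      (use k(1) norm_reduced_h in \<open>auto intro: holomorphic_derivI\<close>)
  have "C1_holo_map (elliptic_chart k) \<Theta>' polydisc"
    unfolding C1_holo_map_def elliptic_chart_def \<Theta>'_def fst_conv snd_conv
    by (intro conjI 1 2 C1_holo_scaled C1_holo_coords C1_holo_diff C1_holo_mult)
  then show ?thesis
  proof (rule holo_chart_inverse_function[OF _ polydisc(2,3) bounded_linear_swap[of 0 0 1]])
    fix v :: complex3
    show "(fst (snd (\<Theta>' 0 v)) + snd (snd (\<Theta>' 0 v)), snd (snd (\<Theta>' 0 v)),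
        0 * fst (snd (\<Theta>' 0 v)) + 0 * snd (snd (\<Theta>' 0 v)) + 1 * fst (\<Theta>' 0 v)) = v"
      using k(2) by (simp add: \<Theta>'_def dscaled_zero reduced_h_def scaled_def prod_eq_iff)
  qed (use that in blast)
qed

section \<open>Derivatives along a curve, and a criterion for solving
  \<open>y'' = 6 y^2\<close>\<close>

lemma C1_holo_field_derivative_along:
  assumes f: "C1_holo f f' S" and "q z \<in> S" and q: "(q has_derivative (\<lambda>h. cscale h w)) (at z)"
  shows "((\<lambda>z. f (q z)) has_field_derivative f' (q z) w) (at z)"
  using has_derivative_compose[OF q C1_holoD(1)[OF f assms(2)]] C1_holoD(2)[OF f assms(2)]
  by (simp add: has_field_derivative_def mult.commute[of _ "f' (q z) w"])

lemma chart2_has_derivative: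
  assumes x: "(x has_field_derivative 6 * (y z)\<^sup>2 + z) (at z)"
    and s: "(s has_field_derivative x z / (2 * s z)) (at z)" "s z \<noteq> 0" "(s z)\<^sup>2 = y z"
  shows "((\<lambda>z. chart2 (s z) (x z) z) has_derivative
    (\<lambda>h. cscale h (cscale (s z) (painleve_field (chart2 (s z) (x z) z))))) (at z)"
proof -
  have *: "(f has_derivative (\<lambda>h. h * c)) (at z)" if "(f has_field_derivative c) (at z)" for f c
    using that by (simp add: has_field_derivative_def mult_commute_abs)
  have "((\<lambda>z. x z / s z ^ 3) has_field_derivative
      s z * (6 + z / s z ^ 4 - 3/2 * (x z / s z ^ 3)\<^sup>2)) (at z)"
    using s(2) by (auto intro!: derivative_eq_intros x s(1) simp flip: s(3))
      (simp add: field_simps eval_nat_numeral)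
  moreover have "((\<lambda>z. z / s z ^ 4) has_field_derivative
      s z * (1 / s z ^ 5 - 2 * (x z / s z ^ 3) * (z / s z ^ 4))) (at z)"
    using s(2) by (auto intro!: derivative_eq_intros s(1)) (simp add: field_simps eval_nat_numeral)
  moreover have "((\<lambda>z. 1 / s z ^ 5) has_field_derivative
      s z * (- 5/2 * (x z / s z ^ 3) * (1 / s z ^ 5))) (at z)"
    using s(2) by (auto intro!: derivative_eq_intros s(1)) (simp add: field_simps eval_nat_numeral)
  ultimately show ?thesis
    unfolding chart2_def cscale_def painleve_field_def prod.case fst_conv snd_conv
    by (intro has_derivative_Pair *)
qed

text \<open>Since \<open>x / xt\<close> does not vanish, \<open>zt\<close> has a local holomorphic
  inverse \<open>g\<close>, and \<open>Y\<close> is \<open>y\<close> composed with \<open>g\<close>.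
  The chain rule gives \<open>dy/dzt = xt\<close> and \<open>dxt/dzt = 6 y^2\<close>.\<close>

lemma integrable_solution_onI:
  assumes D: "open D"
    and y: "\<And>z. z \<in> D \<Longrightarrow> (y has_field_derivative x z) (at z)"
    and zt: "\<And>z. z \<in> D \<Longrightarrow> (zt has_field_derivative x z / xt z) (at z)"
    and xt: "\<And>z. z \<in> D \<Longrightarrow> (xt has_field_derivative 6 * (y z)\<^sup>2 * (x z / xt z)) (at z)"
    and nz: "\<And>z. z \<in> D \<Longrightarrow> x z \<noteq> 0 \<and> xt z \<noteq> 0"
  shows "integrable_solution_on xt y zt D"
  unfolding integrable_solution_on_def
proof
  fix z0 assume z0: "z0 \<in> D"
  have hol: "zt holomorphic_on D"
    using zt holomorphic_on_open[OF D] by blast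
  have dzt: "deriv zt z = x z / xt z" if "z \<in> D" for z
    using zt[OF that] by (rule DERIV_imp_deriv)
  obtain r where r: "r > 0" "ball z0 r \<subseteq> D" "open (zt ` ball z0 r)" "inj_on zt (ball z0 r)"
    using has_complex_derivative_locally_invertible[OF hol z0 D] dzt[OF z0] nz[OF z0] by auto
  let ?N = "ball z0 r"
  obtain g where g: "g holomorphic_on zt ` ?N"
    "\<And>z. z \<in> ?N \<Longrightarrow> deriv zt z * deriv g (zt z) = 1" "\<And>z. z \<in> ?N \<Longrightarrow> g (zt z) = z"
    using holomorphic_has_inverse[OF holomorphic_on_subset[OF hol r(2)] open_ball r(4)] by metis
  have dg: "(g has_field_derivative xt z / x z) (at (zt z))" if z: "z \<in> ?N" for z
  proof -
    have "z \<in> D" using z r(2) by blast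
    then have "deriv g (zt z) = xt z / x z"
      using g(2)[OF z] nz[of z] dzt[of z] by (auto simp: field_simps)
    then show ?thesis
      using holomorphic_derivI[OF g(1) r(3), of "zt z"] z by simp
  qed
  have chain: "((\<lambda>w. f (g w)) has_field_derivative f' * (xt z / x z)) (at (zt z))"
    if "z \<in> ?N" "(f has_field_derivative f') (at z)" for f f' z
  proof -
    have "(f has_field_derivative f') (at (g (zt z)))"
      using that g(3) by simp
    from DERIV_chain2[OF this dg[OF that(1)]] show ?thesis .
  qed
  let ?Y = "\<lambda>w. y (g w)"
  have Y': "(?Y has_field_derivative xt (g w)) (at w)" if "w \<in> zt ` ?N" for w
  proof -
    obtain z where z: "z \<in> ?N" "w = zt z" using \<open>w \<in> zt ` ?N\<close> by blast
    then have "z \<in> D" using r(2) by blast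
    then show ?thesis
      using chain[OF z(1) y[of z]] nz[of z] z(2) g(3)[OF z(1)] by simp
  qed
  have Y'': "(deriv ?Y has_field_derivative 6 * (?Y w)\<^sup>2) (at w)" if w: "w \<in> zt ` ?N" for w
  proof -
    obtain z where z: "z \<in> ?N" "w = zt z" using w by blast
    then have "z \<in> D" using r(2) by blast
    then have "((\<lambda>w. xt (g w)) has_field_derivative 6 * (?Y w)\<^sup>2) (at w)"
      using chain[OF z(1) xt[of z]] nz[of z] z(2) g(3)[OF z(1)] by simp
    then show ?thesis
      by (rule has_field_derivative_transform_within_open[OF _ r(3) w])
        (use Y' DERIV_imp_deriv in \<open>metis (full_types)\<close>)
  qed
  show "\<exists>N Y. open N \<and> z0 \<in> N \<and> N \<subseteq> D \<and> inj_on zt N \<and> open (zt ` N) \<and> Y holomorphic_on (zt ` N) \<and>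
        (\<forall>z\<in>N. y z = Y (zt z) \<and> xt z = deriv Y (zt z)) \<and> (\<forall>w\<in>zt ` N. deriv (deriv Y) w = 6 * (Y w)\<^sup>2)"
  proof (intro exI[of _ ?N] exI[of _ ?Y] conjI ballI)
    show "?Y holomorphic_on (zt ` ?N)"
      using Y' holomorphic_on_open[OF r(3)] by blast
    show "xt z = deriv ?Y (zt z)" if "z \<in> ?N" for z
      using DERIV_imp_deriv[OF Y'[of "zt z"]] that g(3)[OF that] by simp
    show "deriv (deriv ?Y) w = 6 * (?Y w)\<^sup>2" if "w \<in> zt ` ?N" for w
      using DERIV_imp_deriv[OF Y''[OF that]] .
  qed (use r g(3) in auto)
qed

section \<open>Transport of solutions\<close>

text \<open>Pulling the Painleve field back through the chart turns every solution into a curve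
  along the Euler field, with speed factor \<open>- s / groot q\<close>.\<close>

lemma flow_in_chart:
  assumes chart: "holo_chart painleve_chart dpainleve_chart U V \<Psi>"
    and q: "q \<in> U" "q \<in> polydisc" "painleve_chart q = chart2 (s z) (x z) z"
    and x: "(x has_field_derivative 6 * (y z)\<^sup>2 + z) (at z)"
    and s: "(s has_field_derivative x z / (2 * s z)) (at z)" "s z \<noteq> 0" "(s z)\<^sup>2 = y z"
  shows "((\<lambda>z. \<Psi> (chart2 (s z) (x z) z)) has_derivative
    (\<lambda>h. cscale h (cscale (- s z / groot q) (euler q)))) (at z)"
proof -
  let ?w = "cscale (- s z / groot q) (euler q)"
  have bij: "bij (dpainleve_chart q)" and \<Psi>: "(\<Psi> has_derivative inv (dpainleve_chart q)) (at (painleve_chart q))"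
    using chart q(1) by (auto simp: holo_chart_def)
  have lin: "dpainleve_chart q (cscale c v) = cscale c (dpainleve_chart q v)" for c v
    by (rule C1_holo_mapD(2)[OF C1_holo_map_painleve_chart q(2)])
  have "dpainleve_chart q ?w = cscale (s z) (painleve_field (painleve_chart q))"
    unfolding lin dpainleve_chart_euler[OF q(2)] using groot(2)[OF q(2)] by (simp add: cscale_def)
  then have "inv (dpainleve_chart q) (cscale h (cscale (s z) (painleve_field (painleve_chart q)))) = cscale h ?w" for h
    using inv_f_f[OF bij_is_inj[OF bij]] lin by metis
  then show ?thesis
    using has_derivative_compose[OF chart2_has_derivative[where s = s and x = x and y = y and z = z, OF x s] \<Psi>[unfolded q(3)]]
    by (simp add: q(3))
qed

text \<open>As \<open>s' = X s^2 / 2\<close>, this says that \<open>scaled f n\<close> times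
  \<open>s^n\<close> is a constant of motion when \<open>f\<close> has weight \<open>n\<close>;
  weights 4 and 6 give \<open>z0\<close> and \<open>h\<close>.\<close>

lemma scaled_along_flow:
  assumes f: "C1_holo f f' polydisc" and "f' (q z) (euler (q z)) = of_nat n * f (q z)"
    and q: "q z \<in> polydisc" "(q has_derivative (\<lambda>h. cscale h (cscale (- c / groot (q z)) (euler (q z))))) (at z)"
  shows "((\<lambda>z. scaled f n (q z)) has_field_derivative
    - of_nat n / 2 * c * scaled hser 3 (q z) * scaled f n (q z)) (at z)"
proof -
  note C = C1_holo_scaled[OF f, of n]
  have "dscaled f f' n (q z) (cscale (- c / groot (q z)) (euler (q z))) =
    - of_nat n / 2 * c * scaled hser 3 (q z) * scaled f n (q z)"
    unfolding C1_holoD(2)[OF C q(1)] dscaled_euler[OF q(1)] assms(2)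
    using groot(2)[OF q(1)] by simp
  then show ?thesis
    using C1_holo_field_derivative_along[where q = q, OF C q] by simp
qed

lemma sqrt_solution_derivative:
  assumes D: "open D" "z \<in> D" and s: "s holomorphic_on D" "\<And>z. z \<in> D \<Longrightarrow> (s z)\<^sup>2 = y z" "s z \<noteq> 0"
    and y: "(y has_field_derivative y') (at z)"
  shows "(s has_field_derivative y' / (2 * s z)) (at z)"
proof -
  have s': "(s has_field_derivative deriv s z) (at z)"
    by (rule holomorphic_derivI[OF s(1) D])
  have "((\<lambda>z. (s z)\<^sup>2) has_field_derivative 2 * s z * deriv s z) (at z)"
    by (auto intro!: derivative_eq_intros s')
  then have "(y has_field_derivative 2 * s z * deriv s z) (at z)"
    by (rule has_field_derivative_transform_within_open[OF _ D]) (rule s(2))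
  then have "y' = 2 * s z * deriv s z"
    using y by (rule DERIV_unique[rotated])
  with s' s(3) show ?thesis by simp
qed

text \<open>With \<open>z0\<close> and \<open>h\<close> constant along the solution, the criterion
  reduces to two identities: \<open>csqrt (1 + w)\<close> squares to \<open>1 + w\<close>, and
  \<open>k\<close> satisfies its differential equation.\<close>

lemma painleve_to_elliptic:
  assumes chart: "holo_chart painleve_chart dpainleve_chart U V \<Psi>"
    and N: "N \<subseteq> U" "\<And>q. q \<in> N \<Longrightarrow> q \<in> polydisc \<and> scaled hser 3 q \<noteq> 0"
    and k: "k holomorphic_on ball 0 1"
      "\<And>w. w \<in> ball 0 1 \<Longrightarrow> k w + 6 * w * deriv k w = 1 / csqrt (1 + w)"
    and D: "open D" and sol: "PI_solution_on x y D" and s: "s holomorphic_on D"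
    and s_sq: "\<And>z. z \<in> D \<Longrightarrow> s z \<noteq> 0 \<and> (s z)\<^sup>2 = y z"
    and dom: "\<And>z. z \<in> D \<Longrightarrow> chart2 (s z) (x z) z \<in> painleve_chart ` N"
  defines "F \<equiv> \<lambda>p. elliptic_chart k (\<Psi> p)"
  shows "integrable_solution_on (\<lambda>z. x_tilde F (s z) (x z) z) y (\<lambda>z. z_tilde F (s z) (x z) z) D"
proof -
  define Q where "Q = (\<lambda>z. \<Psi> (chart2 (s z) (x z) z))"
  let ?b = "\<lambda>q::complex3. fst (snd q)" and ?c = "\<lambda>q::complex3. snd (snd q)"
  have Q: "Q z \<in> N" "painleve_chart (Q z) = chart2 (s z) (x z) z" if "z \<in> D" for z
  proof -
    obtain q where q: "q \<in> N" "chart2 (s z) (x z) z = painleve_chart q"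
      using dom[OF \<open>z \<in> D\<close>] by blast
    then have "Q z = q"
      using chart N(1) by (auto simp: Q_def holo_chart_def homeomorphism_def)
    with q show "Q z \<in> N" "painleve_chart (Q z) = chart2 (s z) (x z) z" by simp_all
  qed
  have poly: "Q z \<in> polydisc" "scaled hser 3 (Q z) \<noteq> 0" "Q z \<in> U" if "z \<in> D" for z
    using Q(1)[OF that] N by blast+
  \<comment> \<open>The last chart component is \<open>s^(-5)\<close>, so weight 5 yields the
    constant 1.\<close>
  have X: "x z = scaled hser 3 (Q z) * s z ^ 3" and E: "scaled ?b 5 (Q z) * s z ^ 5 = 1" if "z \<in> D" for z
    using Q(2)[OF that] s_sq[OF that] by (auto simp: painleve_chart_def chart2_def)
  have x': "(x has_field_derivative 6 * (y z)\<^sup>2 + z) (at z)" and y': "(y has_field_derivative x z) (at z)"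
    if "z \<in> D" for z
    using sol that by (auto simp: PI_solution_on_def)
  have s': "(s has_field_derivative x z / (2 * s z)) (at z)" if "z \<in> D" for z
    by (rule sqrt_solution_derivative[OF D that s _ _ y'[OF that]]) (use s_sq that in auto)
  have Q': "(Q has_derivative (\<lambda>h. cscale h (cscale (- s z / groot (Q z)) (euler (Q z))))) (at z)"
    if "z \<in> D" for z
    using flow_in_chart[where z = z and x = x and y = y and s = s,
        OF chart poly(3)[OF that] poly(1)[OF that] Q(2)[OF that] x'[OF that] s'[OF that]] s_sq[OF that]
    by (simp add: Q_def)
  have W': "((\<lambda>z. reduced_h (Q z)) has_field_derivative - 3 * s z * scaled hser 3 (Q z) * reduced_h (Q z)) (at z)"
    and A': "((\<lambda>z. scaled fst 4 (Q z)) has_field_derivative - 2 * s z * scaled hser 3 (Q z) * scaled fst 4 (Q z)) (at z)"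
    and E': "((\<lambda>z. scaled ?b 5 (Q z)) has_field_derivative
      - 5/2 * s z * scaled hser 3 (Q z) * scaled ?b 5 (Q z)) (at z)"
    if "z \<in> D" for z
    using scaled_along_flow[where q = Q and c = "s z" and n = 6, OF C1_holo_coords(3) _ poly(1)[OF that] Q'[OF that]]
      scaled_along_flow[where q = Q and c = "s z" and n = 4, OF C1_holo_coords(1) _ poly(1)[OF that] Q'[OF that]]
      scaled_along_flow[where q = Q and c = "s z" and n = 5, OF C1_holo_coords(2) _ poly(1)[OF that] Q'[OF that]]
    by (simp_all add: euler_coords reduced_h_def)
  define xt where "xt = (\<lambda>z. 2 * csqrt (1 + reduced_h (Q z)) * s z ^ 3)"
  define zt where "zt = (\<lambda>z. (scaled fst 4 (Q z) - scaled ?b 5 (Q z) * k (reduced_h (Q z))) * s z ^ 4)"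
  have "(\<lambda>z. x_tilde F (s z) (x z) z) = xt" "(\<lambda>z. z_tilde F (s z) (x z) z) = zt"
    by (simp_all add: x_tilde_def z_tilde_def F_def elliptic_chart_def xt_def zt_def Q_def)
  moreover have "integrable_solution_on xt y zt D"
  proof (rule integrable_solution_onI[where x = x])
    fix z assume z: "z \<in> D"
    define w r X e where "w = reduced_h (Q z)" and "r = csqrt (1 + w)" and "X = scaled hser 3 (Q z)"
      and "e = scaled ?b 5 (Q z)"
    have re: "Re (1 + w) > 0"
      unfolding w_def by (rule Re_one_plus_reduced_h[OF poly(1)[OF z]])
    have "r \<noteq> 0"
      using Re_csqrt_pos[OF re] unfolding r_def by force
    then have r: "r ^ 2 = 1 + w" "r \<noteq> 0"
      by (simp_all add: r_def)
    have sz: "s z \<noteq> 0" "y z = s z ^ 2" using s_sq[OF z] by auto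
    have xz: "x z = X * s z ^ 3" "X \<noteq> 0"
      using X[OF z] poly(2)[OF z] by (simp_all add: X_def)
    have ds: "(s has_field_derivative X * s z ^ 2 / 2) (at z)"
      using s'[OF z] sz(1) by (simp add: xz power2_eq_square power3_eq_cube)
    have xtz: "xt z = 2 * r * s z ^ 3"
      by (simp add: xt_def r_def w_def)
    show "x z \<noteq> 0 \<and> xt z \<noteq> 0"
      using r sz xz xtz by simp
    have q: "x z / xt z = X / (2 * r)"
      using r sz by (simp add: xz xtz)
    show "(y has_field_derivative x z) (at z)" by (rule y'[OF z])
    have dr: "((\<lambda>z. csqrt (1 + reduced_h (Q z))) has_field_derivative - 3 * s z * X * w / (2 * r)) (at z)"
    proof -
      have "((\<lambda>z. 1 + reduced_h (Q z)) has_field_derivative - 3 * s z * X * w) (at z)"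
        using DERIV_add[OF DERIV_const[of 1] W'[OF z]] by (simp add: w_def X_def)
      from DERIV_chain2[OF has_field_derivative_csqrt[OF Re_pos_not_nonpos] this] re
      show ?thesis
        by (simp add: r_def w_def inverse_eq_divide)
    qed
    have "(xt has_field_derivative 2 * (- 3 * s z * X * w / (2 * r)) * s z ^ 3
        + 2 * r * (3 * s z ^ 2 * (X * s z ^ 2 / 2))) (at z)"
      unfolding xt_def
      by (rule DERIV_cong[OF DERIV_mult[OF DERIV_cmult[OF dr, of 2] DERIV_power[OF ds, of 3]]])
        (simp add: r_def w_def)
    \<comment> \<open>The left side is \<open>3 X s^4 (r^2 - w) / r\<close>, and
      \<open>r^2 - w = 1\<close>.\<close>
    moreover have "2 * (- 3 * s z * X * w / (2 * r)) * s z ^ 3 + 2 * r * (3 * s z ^ 2 * (X * s z ^ 2 / 2))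
      = 6 * (y z)\<^sup>2 * (x z / xt z)"
    proof -
      have w: "w = r * r - 1" using r(1) by (simp add: power2_eq_square)
      show ?thesis
        unfolding q sz(2) w using r(2) by (simp add: field_simps power2_eq_square eval_nat_numeral)
    qed
    ultimately show "(xt has_field_derivative 6 * (y z)\<^sup>2 * (x z / xt z)) (at z)" by simp
    have wb: "w \<in> ball 0 1"
      using norm_reduced_h[OF poly(1)[OF z]] by (simp add: w_def)
    have dk: "((\<lambda>z. k (reduced_h (Q z))) has_field_derivative deriv k w * (- 3 * s z * X * w)) (at z)"
      using DERIV_chain2[OF holomorphic_derivI[OF k(1) open_ball wb, unfolded w_def] W'[OF z]]
      by (simp add: w_def X_def)
    let ?A = "scaled fst 4 (Q z)"
    have "(zt has_field_derivative
        (- 2 * s z * X * ?A - (- 5/2 * s z * X * e * k w + deriv k w * (- 3 * s z * X * w) * e)) * s z ^ 4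
        + (?A - e * k w) * (4 * s z ^ 3 * (X * s z ^ 2 / 2))) (at z)"
      unfolding zt_def
      by (rule DERIV_cong[OF DERIV_mult[OF DERIV_diff[OF A'[OF z] DERIV_mult[OF E'[OF z] dk]]
              DERIV_power[OF ds, of 4]]])
        (simp add: e_def w_def X_def)
    \<comment> \<open>The terms with \<open>?A\<close> cancel because \<open>z0\<close> is constant;
      what remains is the combination in the equation for \<open>k\<close>.\<close>
    moreover have "(- 2 * s z * X * ?A - (- 5/2 * s z * X * e * k w + deriv k w * (- 3 * s z * X * w) * e)) * s z ^ 4
        + (?A - e * k w) * (4 * s z ^ 3 * (X * s z ^ 2 / 2))
      = X / 2 * (e * s z ^ 5) * (k w + 6 * w * deriv k w)"
      by (simp add: field_simps eval_nat_numeral)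
    moreover have "\<dots> = x z / xt z"
      unfolding q k(2)[OF wb] by (simp add: E[OF z] e_def flip: r_def)
    ultimately show "(zt has_field_derivative x z / xt z) (at z)" by (simp only:)
  qed (rule D)
  ultimately show ?thesis by simp
qed

text \<open>The flip negates the first coordinate, so a set in the right half plane contains at most
  one representative of each point modulo the choice of branch.\<close>

lemma branch_flip_disjoint:
  assumes "\<And>p. p \<in> S \<Longrightarrow> Re (fst p) > 0"
  shows "S \<inter> branch_flip ` S = {}"
proof -
  have "Re (fst (branch_flip p)) = - Re (fst p)" for p
    by (cases p) simp
  then show ?thesis
    using assms by (smt (verit) disjoint_iff imageE)
qed

theorem proposition3p1:
  shows "\<exists>(F :: complex3 \<Rightarrow> complex3) U.
    (2, 0, 0) \<in> U \<and>
    biholo3_on F U \<and>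
    F (2, 0, 0) = (2, 0, 0) \<and>
    (\<forall>p\<in>U. snd (snd (F p)) = snd (snd p)) \<and>
    U \<inter> branch_flip ` U = {} \<and>
    F ` U \<inter> branch_flip ` (F ` U) = {} \<and>
    (\<forall>D x y s.
       open D \<and> PI_solution_on x y D \<and>
       s holomorphic_on D \<and>
       (\<forall>z\<in>D. s z \<noteq> 0 \<and> (s z)\<^sup>2 = y z \<and> chart2 (s z) (x z) z \<in> U) \<longrightarrow>
       integrable_solution_on
         (\<lambda>z. x_tilde F (s z) (x z) z) y (\<lambda>z. z_tilde F (s z) (x z) z) D)"
proof -
  have "(\<lambda>w. 1 / csqrt (1 + w)) holomorphic_on ball 0 1"
  proof -
    have "Re (1 + w) > 0" if "w \<in> ball 0 1" for w
      using that abs_Re_le_cmod[of w] by simp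
    moreover from this have "csqrt (1 + w) \<noteq> 0" if "w \<in> ball 0 1" for w
      using that by (metis csqrt_eq_0 order.irrefl zero_complex.simps(1))
    ultimately show ?thesis
      by (intro holomorphic_intros Re_pos_not_nonpos) auto
  qed
  then obtain k where k: "k holomorphic_on ball 0 1"
    "\<And>w. w \<in> ball 0 1 \<Longrightarrow> k w + of_nat 6 * w * deriv k w = 1 / csqrt (1 + w)"
    "k 0 = 1 / csqrt (1 + 0)"
    using euler_ode_solution by metis
  have k0: "k 0 = 1" using k(3) by simp
  obtain U1 V1 \<Psi>1 where 1: "holo_chart painleve_chart dpainleve_chart U1 V1 \<Psi>1" "U1 \<subseteq> polydisc" "0 \<in> U1"
    by (rule holo_chart_painleve)
  obtain \<Theta>' U2 V2 \<Psi>2 where 2: "holo_chart (elliptic_chart k) \<Theta>' U2 V2 \<Psi>2" "U2 \<subseteq> polydisc" "0 \<in> U2"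
    by (rule holo_chart_elliptic[OF k(1) k0])
  \<comment> \<open>Shrinking to \<open>Re X > 0\<close> serves twice: it excludes
    \<open>x = 0\<close> along solutions and separates the neighbourhood from its flip.\<close>
  define N where "N = U1 \<inter> U2 \<inter> (polydisc \<inter> scaled hser 3 -` {w. Re w > 0})"
  have "open (polydisc \<inter> scaled hser 3 -` {w. Re w > 0})"
    by (intro continuous_open_preimage C1_holo_continuous[OF C1_holo_scaled[OF C1_holo_hser]]
        polydisc open_halfspace_Re_gt)
  then have oN: "open N"
    using 1(1) 2(1) by (auto simp: N_def holo_chart_def)
  have N: "N \<subseteq> U1" "N \<subseteq> U2" "N \<subseteq> polydisc" "\<And>q. q \<in> N \<Longrightarrow> Re (scaled hser 3 q) > 0"
    by (auto simp: N_def)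
  have N0: "0 \<in> N"
    using 1(3) 2(3) polydisc(3) by (simp add: N_def scaled_def gser_hser_zero dgroot_zero)
  define F where "F = (\<lambda>p. elliptic_chart k (\<Psi>1 p))"
  have F: "F (painleve_chart q) = elliptic_chart k q" if "q \<in> N" for q
    using 1(1) N(1) that by (auto simp: F_def holo_chart_def homeomorphism_def)
  let ?U = "painleve_chart ` N"
  have mem: "(2, 0, 0) \<in> ?U"
    using N0 painleve_chart_zero by (metis imageI)
  have "F (2, 0, 0) = (2, 0, 0)"
    using F[OF N0] by (simp add: painleve_chart_zero elliptic_chart_def scaled_def reduced_h_def dgroot_zero)
  moreover have "biholo3_on F ?U"
    unfolding F_def by (rule biholo3_on_transition[OF 1(1) 2(1) oN N(1,2)])
  \<comment> \<open>Both charts have the same last component, which is why \<open>y\<close> stays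
    unchanged.\<close>
  moreover have "\<forall>p\<in>?U. snd (snd (F p)) = snd (snd p)"
    using F by (auto simp: elliptic_chart_def painleve_chart_def)
  moreover have "?U \<inter> branch_flip ` ?U = {}"
    by (rule branch_flip_disjoint) (use N(4) in \<open>auto simp: painleve_chart_def\<close>)
  moreover have "F ` ?U \<inter> branch_flip ` (F ` ?U) = {}"
  proof (rule branch_flip_disjoint)
    fix p assume "p \<in> F ` ?U"
    then obtain q where q: "q \<in> N" "p = elliptic_chart k q" using F by auto
    then have "Re (csqrt (1 + reduced_h q)) > 0"
      using N(3) Re_one_plus_reduced_h by (intro Re_csqrt_pos) blast
    then show "Re (fst p) > 0"
      by (simp add: q elliptic_chart_def)
  qed
  moreover have "integrable_solution_on (\<lambda>z. x_tilde F (s z) (x z) z) y (\<lambda>z. z_tilde F (s z) (x z) z) D"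
    if "open D \<and> PI_solution_on x y D \<and> s holomorphic_on D \<and>
       (\<forall>z\<in>D. s z \<noteq> 0 \<and> (s z)\<^sup>2 = y z \<and> chart2 (s z) (x z) z \<in> ?U)" for D x y s
    unfolding F_def
  proof (rule painleve_to_elliptic[OF 1(1) N(1)])
    show "q \<in> polydisc \<and> scaled hser 3 q \<noteq> 0" if "q \<in> N" for q
      using N(3) N(4)[OF that] that by auto
  qed (use that k in auto)
  ultimately show ?thesis
    using mem by (intro exI[of _ F] exI[of _ ?U]) blast
qed

end
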